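(* Let $G=\{g_1:=0,g_2,\ldots,g_n\}$ be a finite Abelian group of order $n\ge 3$, and let $$L_G=\Big\{{\boldsymbol x}=(x_1,\ldots,x_n)\in\mathbb{Z}^n:\ \sum_{i=1}^n x_i=0,\ \sum_{j=2}^n x_j g_j=0\Big\}.$$ Then $\operatorname{Aut}(L_G)\cong C_2\times(G\rtimes\operatorname{Aut}(G))$ if and only if $n\in\{3,4,6\}$ or $n\ge 12$.
   Context: $\operatorname{Aut}(L_G)$ denotes the group of orthogonal transformations of $\operatorname{span}_{\mathbb R}L_G$ mapping $L_G$ onto itself. $C_k$ denotes the cyclic group of order $k$, $\operatorname{Aut}(G)$ the automorphism group of the group $G$, and $G\rtimes\operatorname{Aut}(G)$ the semidirect product (holomorph) with respect to the natural action of $\operatorname{Aut}(G)$ on $G$. *)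

theory Defs
  imports
    "HOL-Analysis.Analysis"
    "HOL-Algebra.Bij"
    "HOL-Algebra.FiniteProduct"
    "HOL-Algebra.Elementary_Groups"
begin

text \<open>
  The elements of \<open>G\<close> are listed as \<open>g i\<close>, with \<open>i\<close> ranging over the finite index type \<open>'n\<close>
  of the coordinates; \<open>i\<^sub>0\<close> is the index of the neutral element. As \<open>G\<close> is written
  multiplicatively in HOL-Algebra, the sum of the \<open>x\<^sub>j g\<^sub>j\<close> becomes a product of powers.
\<close>

definition group_lattice ::
    "('a, 'b) monoid_scheme \<Rightarrow> ('n::finite \<Rightarrow> 'a) \<Rightarrow> 'n \<Rightarrow> (real ^ 'n) set" where
  "group_lattice G g i\<^sub>0 =
     {(\<chi> i. real_of_int (x $ i)) | x :: int ^ 'n.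
        (\<Sum>i\<in>UNIV. x $ i) = 0 \<and>
        (\<Otimes>\<^bsub>G\<^esub>j\<in>UNIV - {i\<^sub>0}. g j [^]\<^bsub>G\<^esub> (x $ j)) = \<one>\<^bsub>G\<^esub>}"

text \<open>
  \<open>orthogonal_transformation\<close> of HOL-Analysis only concerns maps of the whole space, so
  the orthogonal transformations of a linear subspace are defined here. As for \<open>Bij\<close> and
  \<open>auto\<close>, the maps are taken extensional, so that each is determined by its values on the subspace.
\<close>

definition orthogonal_maps_on :: "'v::real_inner set \<Rightarrow> ('v \<Rightarrow> 'v) set" where
  "orthogonal_maps_on V =
     {f \<in> Bij V.
        (\<forall>v\<in>V. \<forall>w\<in>V. f (v + w) = f v + f w) \<and>
        (\<forall>c. \<forall>v\<in>V. f (c *\<^sub>R v) = c *\<^sub>R f v) \<and>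
        (\<forall>v\<in>V. \<forall>w\<in>V. f v \<bullet> f w = v \<bullet> w)}"

definition lattice_auto :: "'v::real_inner set \<Rightarrow> ('v \<Rightarrow> 'v) set" where
  "lattice_auto L = {f \<in> orthogonal_maps_on (span L). f ` L = L}"

definition LatticeAutoGroup :: "'v::real_inner set \<Rightarrow> ('v \<Rightarrow> 'v) monoid" where
  "LatticeAutoGroup L = BijGroup (span L) \<lparr>carrier := lattice_auto L\<rparr>"

definition semidirect_prod ::
    "('a, 'c) monoid_scheme \<Rightarrow> ('b, 'd) monoid_scheme \<Rightarrow> ('b \<Rightarrow> 'a \<Rightarrow> 'a) \<Rightarrow> ('a \<times> 'b) monoid" where
  "semidirect_prod N H \<phi> =
     \<lparr>carrier = carrier N \<times> carrier H,
      mult = (\<lambda>(a, h) (b, k). (a \<otimes>\<^bsub>N\<^esub> \<phi> h b, h \<otimes>\<^bsub>H\<^esub> k)),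
      one = (\<one>\<^bsub>N\<^esub>, \<one>\<^bsub>H\<^esub>)\<rparr>"

definition holomorph :: "('a, 'c) monoid_scheme \<Rightarrow> ('a \<times> ('a \<Rightarrow> 'a)) monoid" where
  "holomorph G = semidirect_prod G (AutoGroup G) (\<lambda>f. f)"

end

theory Submission
  imports Defs "HOL-Algebra.Sylow" "HOL-Algebra.Multiplicative_Group"
begin

text \<open>
  Write \<open>p\<^sub>c\<close> for the projection of the unit vector \<open>e\<^sub>c\<close> to \<open>span L\<close>. The vectors \<open>\<plusminus>p\<^sub>c\<close> lie in the
  dual lattice and have squared norm \<open>1 - 1/n\<close>. If the dual lattice has no other vectors of
  that norm, then an automorphism of \<open>L\<close> permutes the \<open>\<plusminus>p\<^sub>c\<close>; as \<open>p\<^sub>c \<bullet> p\<^sub>d = -1/n\<close> for \<open>c \<noteq> d\<close>, it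
  is, up to one global sign, a permutation of the coordinates, and preserving the relations
  \<open>e\<^sub>a\<^sub>b + e\<^sub>1 - e\<^sub>a - e\<^sub>b \<in> L\<close> forces this permutation to be of the form \<open>a \<mapsto> t h(a)\<close>.

  The coordinates of a dual vector are, modulo \<open>\<int>\<close>, a translate of a character of \<open>G\<close>, of order
  \<open>m\<close> say. For \<open>m = 1\<close> the vector is the projection of an integer vector and the norm condition
  is elementary. For \<open>m > 1\<close> the squared norm is at least \<open>n(m\<^sup>2 - 1)/(12m\<^sup>2)\<close>, the value for equally
  spaced coordinates. This exceeds \<open>1 - 1/n\<close> when \<open>n \<ge> 15\<close>, and the remaining pairs
  \<open>(n, m)\<close> with \<open>n \<in> {3, 4, 6, 12, 13, 14}\<close> are either excluded by the same bound or by a congruence.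

  For \<open>n \<in> {5, 7, 8, 9, 10, 11}\<close> there is an explicit automorphism which is not a signed
  permutation. As \<open>C\<^sub>2 \<times> (G \<rtimes> Aut G)\<close> always embeds into the finite group \<open>Aut L\<close>, the two groups then
  differ in order.
\<close>

section \<open>Sums of squares of integers\<close>

text \<open>Pairing with p_c reads off the coordinate at c, so p_c is dual because lattice vectors
  are integral. Conversely, pairing a dual vector with e_ab + e_1 - e_a - e_b makes its coordinates
  additive modulo integers up to a translation; no other consequence of duality enters. The 12 in
  the bound is that of the variance of an arithmetic progression: along a, a a_0, ..., a a_0^(m-1)
  the scaled coordinates are m integers in distinct residue classes, whose squared deviations from
  any point add up to at least m(m^2 - 1)/12. The weakest case is m = 2, where the bound is n/16 and
  exceeds 1 - 1/n only from n = 15 on; below that, divisibility and integrality have to decide.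
  Abelian groups of order 5, 7, 10 and 11 are cyclic, so one integer matrix per order gives the
  extra automorphism. Orders 8 and 9 have several isomorphism types; the constructions there use
  nothing but a subgroup of index 2 or 3 and treat all types at once.\<close>

lemma sum_square_deviation_ge:
  fixes Y :: "int set" and c :: real
  assumes "finite Y"
  shows "real (card Y) * ((real (card Y))\<^sup>2 - 1) / 12 \<le> (\<Sum>y\<in>Y. (real_of_int y - c)\<^sup>2)"
  using assms
proof (induction "card Y" arbitrary: Y rule: less_induct)
  case less
  show ?case
  proof (cases "card Y \<le> 1")
    case True
    then have "card Y = 0 \<or> card Y = 1" by auto
    then show ?thesis by (auto simp: sum_nonneg)
  next
    case False
    \<comment> \<open>Equality holds for consecutive integers about their mean. The two extreme
      points lie at least \<open>card Y - 1\<close> apart, so together they contribute at least half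
      the square of that, whatever \<open>c\<close> is; the rest is the same problem with two points
      fewer.\<close>
    define p where "p = Min Y"
    define q where "q = Max Y"
    have ne: "Y \<noteq> {}" using False by auto
    have pq: "p \<in> Y" "q \<in> Y" using less.prems ne by (auto simp: p_def q_def)
    have sub: "Y \<subseteq> {p..q}" using less.prems by (auto simp: p_def q_def)
    have "p \<noteq> q"
    proof
      assume "p = q"
      then have "card Y \<le> card {p}" using sub by (intro card_mono) auto
      with False show False by simp
    qed
    have "card Y \<le> card {p..q}" using sub by (intro card_mono) auto
    then have gap: "real (card Y) - 1 \<le> real_of_int q - real_of_int p" using False by auto
    define Y' where "Y' = Y - {p, q}"
    have cY': "card Y' = card Y - 2"
      unfolding Y'_def using pq \<open>p \<noteq> q\<close> less.prems by (simp add: card_Diff_subset)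
    define k where "k = real (card Y')"
    have k: "real (card Y) = k + 2" using cY' False by (simp add: k_def)
    have IH: "k * (k\<^sup>2 - 1) / 12 \<le> (\<Sum>y\<in>Y'. (real_of_int y - c)\<^sup>2)"
      unfolding k_def using False less.prems cY' by (intro less.hyps) (auto simp: Y'_def)
    have split: "(\<Sum>y\<in>Y. (real_of_int y - c)\<^sup>2) =
        (real_of_int p - c)\<^sup>2 + ((real_of_int q - c)\<^sup>2 + (\<Sum>y\<in>Y'. (real_of_int y - c)\<^sup>2))"
    proof -
      have "Y = insert p (insert q Y')" using pq by (auto simp: Y'_def)
      moreover have "p \<notin> insert q Y'" "q \<notin> Y'" "finite Y'"
        using \<open>p \<noteq> q\<close> less.prems by (auto simp: Y'_def)
      ultimately show ?thesis by simp
    qed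
    have "(k + 1)\<^sup>2 \<le> (real_of_int q - real_of_int p)\<^sup>2"
      using gap k by (intro power_mono) (auto simp: k_def)
    also have "\<dots> \<le> 2 * ((real_of_int p - c)\<^sup>2 + (real_of_int q - c)\<^sup>2)"
      using zero_le_power2[of "real_of_int p + real_of_int q - 2 * c"]
      by (simp add: power2_eq_square algebra_simps)
    finally have "(k + 1)\<^sup>2 / 2 \<le> (real_of_int p - c)\<^sup>2 + (real_of_int q - c)\<^sup>2" by simp
    moreover have "(k + 2) * ((k + 2)\<^sup>2 - 1) / 12 = (k + 1)\<^sup>2 / 2 + k * (k\<^sup>2 - 1) / 12"
      by (simp add: field_simps power2_eq_square)
    ultimately show ?thesis using IH split k by simp
  qed
qed

text \<open>The left side of \<open>var\<close> is half the sum of \<open>(x a - x b)^2\<close> over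
  ordered pairs. Split \<open>A\<close> into the set \<open>B\<close> where the maximum is attained
  and its complement \<open>C\<close>: the pairs across contribute at least
  \<open>card B * card C\<close>, and a product of two positive integers with sum \<open>n\<close>
  is at most \<open>n - 1\<close> only if one of them is 1. Then equality holds throughout and all
  differences across are exactly 1. The lone point lies above or below the rest, which is the sign
  \<open>s\<close>.\<close>

lemma near_constant_of_variance:
  fixes x :: "'a \<Rightarrow> int"
  assumes fin: "finite A" and card: "card A = n" and "n \<ge> 3"
    and var: "int n * (\<Sum>a\<in>A. (x a)\<^sup>2) - (\<Sum>a\<in>A. x a)\<^sup>2 = int n - 1"
  obtains c k s where "c \<in> A" "s = 1 \<or> s = -1" "\<And>a. a \<in> A \<Longrightarrow> x a = k + (if a = c then s else 0)"
proof -
  have dbl: "(\<Sum>a\<in>A. \<Sum>b\<in>A. (x a - x b)\<^sup>2) = 2 * (int n - 1)"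
  proof -
    have double: "D = q + q - 2 * s \<Longrightarrow> D = 2 * (q - s)" for D q s :: int by simp
    have "(\<Sum>a\<in>A. \<Sum>b\<in>A. (x a - x b)\<^sup>2)
        = (\<Sum>a\<in>A. \<Sum>b\<in>A. (x a)\<^sup>2) + (\<Sum>a\<in>A. \<Sum>b\<in>A. (x b)\<^sup>2) - 2 * (\<Sum>a\<in>A. \<Sum>b\<in>A. x a * x b)"
      by (simp add: power2_diff sum.distrib sum_subtractf sum_distrib_left mult.assoc)
    also have "(\<Sum>a\<in>A. \<Sum>b\<in>A. (x a)\<^sup>2) = int n * (\<Sum>a\<in>A. (x a)\<^sup>2)"
      by (simp add: card sum_distrib_left)
    also have "(\<Sum>a\<in>A. \<Sum>b\<in>A. (x b)\<^sup>2) = int n * (\<Sum>a\<in>A. (x a)\<^sup>2)"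
      by (simp add: card)
    also have "(\<Sum>a\<in>A. \<Sum>b\<in>A. x a * x b) = (\<Sum>a\<in>A. x a)\<^sup>2"
      by (simp add: sum_product power2_eq_square)
    finally have "(\<Sum>a\<in>A. \<Sum>b\<in>A. (x a - x b)\<^sup>2) =
        2 * (int n * (\<Sum>a\<in>A. (x a)\<^sup>2) - (\<Sum>a\<in>A. x a)\<^sup>2)" by (rule double)
    then show ?thesis unfolding var .
  qed
  have ne: "A \<noteq> {}" using card \<open>n \<ge> 3\<close> by auto
  define M where "M = Max (x ` A)"
  have leM: "x a \<le> M" if "a \<in> A" for a using that fin by (auto simp: M_def)
  have "M \<in> x ` A" unfolding M_def using fin ne by (intro Max_in) auto
  then obtain b0 where b0: "b0 \<in> A" "x b0 = M" by auto
  define B where "B = {a \<in> A. x a = M}"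
  define C where "C = A - B"
  have finBC: "finite B" "finite C" using fin by (auto simp: B_def C_def)
  have BC: "A = B \<union> C" "B \<inter> C = {}" by (auto simp: B_def C_def)
  have cards: "card B + card C = n" using card BC finBC card_Un_disjoint by metis
  have "card B \<ge> 1" using b0 finBC by (metis (mono_tags, lifting) B_def One_nat_def Suc_leI card_gt_0_iff empty_iff mem_Collect_eq)
  have ltM: "x a \<le> M - 1" if "a \<in> C" for a
    using that leM[of a] by (auto simp: C_def B_def)
  have sq1: "(x a - x b)\<^sup>2 \<ge> 1" if "a \<in> B" "b \<in> C" for a b
  proof -
    have "1 \<le> x a - x b" using that ltM[of b] by (auto simp: B_def)
    then have "1\<^sup>2 \<le> (x a - x b)\<^sup>2" by (intro power_mono) auto
    then show ?thesis by simp
  qed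
  have cross: "2 * (\<Sum>a\<in>B. \<Sum>b\<in>C. (x a - x b)\<^sup>2) \<le> 2 * (int n - 1)"
  proof -
    have "(\<Sum>a\<in>A. \<Sum>b\<in>A. (x a - x b)\<^sup>2) =
        (\<Sum>a\<in>B. \<Sum>b\<in>B. (x a - x b)\<^sup>2) + (\<Sum>a\<in>B. \<Sum>b\<in>C. (x a - x b)\<^sup>2)
        + ((\<Sum>a\<in>C. \<Sum>b\<in>B. (x a - x b)\<^sup>2) + (\<Sum>a\<in>C. \<Sum>b\<in>C. (x a - x b)\<^sup>2))"
      using BC finBC by (simp add: sum.union_disjoint sum.distrib)
    moreover have "(\<Sum>a\<in>C. \<Sum>b\<in>B. (x a - x b)\<^sup>2) = (\<Sum>a\<in>B. \<Sum>b\<in>C. (x a - x b)\<^sup>2)"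
      by (subst sum.swap) (simp add: power2_commute)
    moreover have "(\<Sum>a\<in>B. \<Sum>b\<in>B. (x a - x b)\<^sup>2) \<ge> 0" "(\<Sum>a\<in>C. \<Sum>b\<in>C. (x a - x b)\<^sup>2) \<ge> 0"
      by (simp_all add: sum_nonneg)
    ultimately show ?thesis using dbl by linarith
  qed
  have low: "int (card B) * int (card C) \<le> (\<Sum>a\<in>B. \<Sum>b\<in>C. (x a - x b)\<^sup>2)"
  proof -
    have "int (card B) * int (card C) = (\<Sum>a\<in>B. \<Sum>b\<in>C. 1)" by simp
    also have "\<dots> \<le> (\<Sum>a\<in>B. \<Sum>b\<in>C. (x a - x b)\<^sup>2)" using sq1 by (intro sum_mono)
    finally show ?thesis .
  qed
  have "C \<noteq> {}"
  proof
    assume "C = {}"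
    then have "A = B" using BC by simp
    then have "x a = M" if "a \<in> A" for a using that unfolding B_def by blast
    then have "(\<Sum>a\<in>A. \<Sum>b\<in>A. (x a - x b)\<^sup>2) = 0"
      by (intro sum.neutral ballI) simp
    with dbl \<open>n \<ge> 3\<close> show False by simp
  qed
  then have "card C \<ge> 1" using finBC by (simp add: Suc_leI card_gt_0_iff)
  have prod: "(int (card B) - 1) * (int (card C) - 1) \<le> 0"
    using low cross cards by (simp add: algebra_simps flip: of_nat_add)
  then have one: "card B = 1 \<or> card C = 1"
    using \<open>card B \<ge> 1\<close> \<open>card C \<ge> 1\<close> by (auto simp: mult_le_0_iff)
  then have eqn: "int (card B) * int (card C) = int n - 1" using cards by auto
  have diff1: "x a - x b = 1" if "a \<in> B" "b \<in> C" for a b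
  proof -
    have le0: "(\<Sum>a\<in>B. \<Sum>b\<in>C. (x a - x b)\<^sup>2 - 1) \<le> 0"
      using cross eqn by (simp add: sum_subtractf)
    have nonneg: "0 \<le> (x a - x b)\<^sup>2 - 1" if "a \<in> B" "b \<in> C" for a b
      using sq1[OF that] by linarith
    then have inner: "0 \<le> (\<Sum>b\<in>C. (x a - x b)\<^sup>2 - 1)" if "a \<in> B" for a
      using that by (intro sum_nonneg) blast
    have "(\<Sum>a\<in>B. \<Sum>b\<in>C. (x a - x b)\<^sup>2 - 1) = 0"
      by (rule antisym[OF le0 sum_nonneg[OF inner]])
    then have "(\<Sum>b\<in>C. (x a - x b)\<^sup>2 - 1) = 0"
      by (rule sum_nonneg_0[where f = "\<lambda>a. \<Sum>b\<in>C. (x a - x b)\<^sup>2 - 1", OF finBC(1) _ _ \<open>a \<in> B\<close>, rotated]) (rule inner)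
    then have "(x a - x b)\<^sup>2 - 1 = 0"
      by (rule sum_nonneg_0[where f = "\<lambda>b. (x a - x b)\<^sup>2 - 1", OF finBC(2) _ _ \<open>b \<in> C\<close>, rotated])
        (rule nonneg[OF \<open>a \<in> B\<close>])
    then have "(x a - x b)\<^sup>2 = 1" by simp
    moreover have "x a - x b \<ge> 1" using that ltM[of b] by (auto simp: B_def)
    ultimately show ?thesis by (auto simp: power2_eq_1_iff)
  qed
  from one show ?thesis
  proof
    assume "card B = 1"
    then obtain c where c: "B = {c}" by (rule card_1_singletonE)
    have xc: "x c = M" using c unfolding B_def by blast
    show ?thesis
    proof (rule that[of c 1 "M - 1"])
      show "c \<in> A" using c BC by auto
      show "x a = M - 1 + (if a = c then 1 else 0)" if "a \<in> A" for a
      proof (cases "a = c")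
        case True
        then show ?thesis using xc by simp
      next
        case False
        then have "a \<in> C" using that c BC by auto
        then show ?thesis using False diff1[of c a] c xc by simp
      qed
    qed simp
  next
    assume "card C = 1"
    then obtain c where c: "C = {c}" by (rule card_1_singletonE)
    show ?thesis
    proof (rule that[of c "-1" M])
      show "c \<in> A" using c BC by auto
      show "x a = M + (if a = c then -1 else 0)" if "a \<in> A" for a
      proof (cases "a = c")
        case True
        then show ?thesis using diff1[of b0 a] b0 c by (simp add: B_def)
      next
        case False
        then have "a \<in> B" using that c BC by auto
        then show ?thesis using False by (simp add: B_def)
      qed
    qed simp
  qed
qed

text \<open>The left side is \<open>(Z + 1)^2 + 1\<close>, and a square is 0 or 1 modulo 4.\<close>

lemma not_4_dvd_square_plus_2:
  fixes Z t :: int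
  shows "Z\<^sup>2 + 2 * Z + 2 \<noteq> 4 * t"
proof
  assume eq: "Z\<^sup>2 + 2 * Z + 2 = 4 * t"
  then have "Z\<^sup>2 = 2 * (2 * t - Z - 1)" by simp
  then have "even (Z\<^sup>2)" by (rule dvdI)
  then obtain w where "Z = 2 * w" by (auto elim: evenE)
  with eq have "4 * w\<^sup>2 + 4 * w + 2 = 4 * t" by (simp add: power_mult_distrib)
  then show False by presburger
qed

text \<open>
  These are the pairs for which the bound from equally spaced coordinates does not suffice.
  Writing \<open>u = r + m z\<close> with the residues \<open>r\<close>, the sums of \<open>r\<close> and \<open>r\<^sup>2\<close> are known, and the equation
  fails modulo a suitable integer.
\<close>

lemma equidistributed_variance_neq:
  fixes u :: "'a \<Rightarrow> int" and n m :: nat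
  assumes fin: "finite A"
    and cases: "(n, m) \<in> {(3,3),(4,2),(4,4),(6,2),(6,3),(6,6),(12,2),(12,3),(14,2)}"
    and equi: "\<And>\<phi> :: int \<Rightarrow> int. int m * (\<Sum>a\<in>A. \<phi> (u a mod int m)) = int n * (\<Sum>k<m. \<phi> (int k))"
  shows "int n * (\<Sum>a\<in>A. (u a)\<^sup>2) - (\<Sum>a\<in>A. u a)\<^sup>2 \<noteq> (int m)\<^sup>2 * (int n - 1)"
proof
  assume eq: "int n * (\<Sum>a\<in>A. (u a)\<^sup>2) - (\<Sum>a\<in>A. u a)\<^sup>2 = (int m)\<^sup>2 * (int n - 1)"
  define r where "r a = u a mod int m" for a
  define z where "z a = u a div int m" for a
  have u: "u a = r a + int m * z a" for a by (simp add: r_def z_def)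
  define Z where "Z = (\<Sum>a\<in>A. z a)"
  define P where "P = (\<Sum>a\<in>A. r a * z a)"
  define R where "R = (\<Sum>a\<in>A. (z a)\<^sup>2)"
  have S: "(\<Sum>a\<in>A. u a) = (\<Sum>a\<in>A. r a) + int m * Z"
    unfolding u Z_def by (simp add: sum.distrib sum_distrib_left)
  have Q: "(\<Sum>a\<in>A. (u a)\<^sup>2) = (\<Sum>a\<in>A. (r a)\<^sup>2) + 2 * int m * P + (int m)\<^sup>2 * R"
    unfolding u P_def R_def
    by (simp add: sum.distrib sum_distrib_left power2_sum power_mult_distrib algebra_simps)
  have e1: "int m * (\<Sum>a\<in>A. r a) = int n * (\<Sum>k<m. int k)"
    using equi[of "\<lambda>k. k"] by (simp add: r_def)
  have e2: "int m * (\<Sum>a\<in>A. (r a)\<^sup>2) = int n * (\<Sum>k<m. (int k)\<^sup>2)"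
    using equi[of "\<lambda>k. k\<^sup>2"] by (simp add: r_def)
  \<comment> \<open>As \<open>m\<close> divides \<open>n\<close>, all terms with \<open>Z\<close>,
    \<open>P\<close> or \<open>R\<close> are multiples of \<open>m^2\<close>, and what remains is
    the constant \<open>m^2 (n - 1) - n^2 (m^2 - 1) / 12\<close>. It is no multiple of
    \<open>m^2\<close> except for (4,2) and (12,2). There it is 8, and after division by 4 a
    quadratic in \<open>Z\<close> is left to be examined modulo 4.\<close>
  consider "n = 3" "m = 3" | "n = 4" "m = 2" | "n = 4" "m = 4" | "n = 6" "m = 2" | "n = 6" "m = 3"
    | "n = 6" "m = 6" | "n = 12" "m = 2" | "n = 12" "m = 3" | "n = 14" "m = 2"
    using cases by auto
  then show False
  proof cases
    case 1
    have r: "(\<Sum>a\<in>A. r a) = 3" "(\<Sum>a\<in>A. (r a)\<^sup>2) = 5" using e1 e2 1 by (simp_all add: eval_nat_numeral)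
    have "9 * (2 * P + 3 * R - 2 * Z - 1 * Z\<^sup>2) = (12::int)"
      using eq[unfolded S Q r 1] by (simp add: power2_sum power_mult_distrib algebra_simps)
    then have "12 mod 9 = (0::int)" by (metis mod_mult_self1_is_0)
    then show False by simp
  next
    case 2
    have r: "(\<Sum>a\<in>A. r a) = 2" "(\<Sum>a\<in>A. (r a)\<^sup>2) = 2" using e1 e2 2 by (simp_all add: eval_nat_numeral)
    have "Z\<^sup>2 + 2 * Z + 2 = 4 * (P + R)"
      using eq[unfolded S Q r 2] by (simp add: power2_sum power_mult_distrib algebra_simps)
    then show False by (rule notE[OF not_4_dvd_square_plus_2])
  next
    case 3
    have r: "(\<Sum>a\<in>A. r a) = 6" "(\<Sum>a\<in>A. (r a)\<^sup>2) = 14" using e1 e2 3 by (simp_all add: eval_nat_numeral)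
    have "16 * (2 * P + 4 * R - 3 * Z - 1 * Z\<^sup>2) = (28::int)"
      using eq[unfolded S Q r 3] by (simp add: power2_sum power_mult_distrib algebra_simps)
    then have "28 mod 16 = (0::int)" by (metis mod_mult_self1_is_0)
    then show False by simp
  next
    case 4
    have r: "(\<Sum>a\<in>A. r a) = 3" "(\<Sum>a\<in>A. (r a)\<^sup>2) = 3" using e1 e2 4 by (simp_all add: eval_nat_numeral)
    have "4 * (6 * P + 6 * R - 3 * Z - 1 * Z\<^sup>2) = (11::int)"
      using eq[unfolded S Q r 4] by (simp add: power2_sum power_mult_distrib algebra_simps)
    then have "11 mod 4 = (0::int)" by (metis mod_mult_self1_is_0)
    then show False by simp
  next
    case 5
    have r: "(\<Sum>a\<in>A. r a) = 6" "(\<Sum>a\<in>A. (r a)\<^sup>2) = 10" using e1 e2 5 by (simp_all add: eval_nat_numeral)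
    have "9 * (4 * P + 6 * R - 4 * Z - 1 * Z\<^sup>2) = (21::int)"
      using eq[unfolded S Q r 5] by (simp add: power2_sum power_mult_distrib algebra_simps)
    then have "21 mod 9 = (0::int)" by (metis mod_mult_self1_is_0)
    then show False by simp
  next
    case 6
    have r: "(\<Sum>a\<in>A. r a) = 15" "(\<Sum>a\<in>A. (r a)\<^sup>2) = 55" using e1 e2 6 by (simp_all add: eval_nat_numeral)
    have "36 * (2 * P + 6 * R - 5 * Z - 1 * Z\<^sup>2) = (75::int)"
      using eq[unfolded S Q r 6] by (simp add: power2_sum power_mult_distrib algebra_simps)
    then have "75 mod 36 = (0::int)" by (metis mod_mult_self1_is_0)
    then show False by simp
  next
    case 7
    have r: "(\<Sum>a\<in>A. r a) = 6" "(\<Sum>a\<in>A. (r a)\<^sup>2) = 6" using e1 e2 7 by (simp_all add: eval_nat_numeral)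
    have "Z\<^sup>2 + 2 * Z + 2 = 4 * (3 * P + 3 * R - Z)"
      using eq[unfolded S Q r 7] by (simp add: power2_sum power_mult_distrib algebra_simps)
    then show False by (rule notE[OF not_4_dvd_square_plus_2])
  next
    case 8
    have r: "(\<Sum>a\<in>A. r a) = 12" "(\<Sum>a\<in>A. (r a)\<^sup>2) = 20" using e1 e2 8 by (simp_all add: eval_nat_numeral)
    have "9 * (8 * P + 12 * R - 8 * Z - 1 * Z\<^sup>2) = (3::int)"
      using eq[unfolded S Q r 8] by (simp add: power2_sum power_mult_distrib algebra_simps)
    then have "3 mod 9 = (0::int)" by (metis mod_mult_self1_is_0)
    then show False by simp
  next
    case 9
    have r: "(\<Sum>a\<in>A. r a) = 7" "(\<Sum>a\<in>A. (r a)\<^sup>2) = 7" using e1 e2 9 by (simp_all add: eval_nat_numeral)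
    have "4 * (14 * P + 14 * R - 7 * Z - 1 * Z\<^sup>2) = (3::int)"
      using eq[unfolded S Q r 9] by (simp add: power2_sum power_mult_distrib algebra_simps)
    then have "3 mod 4 = (0::int)" by (metis mod_mult_self1_is_0)
    then show False by simp
  qed
qed

text \<open>The factor \<open>1 - 1/m^2\<close> grows with \<open>m\<close>. Its value 3/4 at
  \<open>m = 2\<close> already forces \<open>n < 15\<close>; its value 15/16 at \<open>m = 4\<close>
  rules out \<open>m \<ge> 4\<close> for \<open>n\<close> = 12, 13, 14. For \<open>n\<close> = 3, 4,
  6 every divisor from 2 on is in the list.\<close>

lemma equidistributed_variance_bound:
  fixes n m :: nat
  assumes "m dvd n" "m \<ge> 2" and n: "n \<in> {3, 4, 6} \<or> n \<ge> 12"
    and le: "(real n)\<^sup>2 * ((real m)\<^sup>2 - 1) \<le> 12 * ((real m)\<^sup>2 * (real n - 1))"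
  shows "(n, m) \<in> {(3,3),(4,2),(4,4),(6,2),(6,3),(6,6),(12,2),(12,3),(14,2)}"
proof -
  have m0: "(real m)\<^sup>2 > 0" using \<open>m \<ge> 2\<close> by simp
  have factor: "(1 - \<epsilon>) * (real n)\<^sup>2 \<le> 12 * (real n - 1)" if "1 \<le> \<epsilon> * (real m)\<^sup>2" for \<epsilon>
  proof -
    have "(1 - \<epsilon>) * (real m)\<^sup>2 \<le> (real m)\<^sup>2 - 1" using that by (simp add: algebra_simps)
    then have "(real n)\<^sup>2 * ((1 - \<epsilon>) * (real m)\<^sup>2) \<le> (real n)\<^sup>2 * ((real m)\<^sup>2 - 1)"
      by (intro mult_left_mono) auto
    with le have "(real m)\<^sup>2 * ((1 - \<epsilon>) * (real n)\<^sup>2) \<le> (real m)\<^sup>2 * (12 * (real n - 1))"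
      by (simp add: algebra_simps)
    then show ?thesis using m0 by (simp only: mult_le_cancel_left_pos)
  qed
  have "(2::real)\<^sup>2 \<le> (real m)\<^sup>2" using \<open>m \<ge> 2\<close> by (intro power_mono) auto
  then have "1 \<le> (1/4) * (real m)\<^sup>2" by simp
  from factor[OF this] have f2: "(real n)\<^sup>2 \<le> 16 * real n - 16" by simp
  have "n < 15"
  proof (rule ccontr)
    assume "\<not> n < 15"
    then have "real n \<ge> 15" by simp
    then have "15 * (real n - 1) \<le> real n * (real n - 1)" by (intro mult_right_mono) auto
    with f2 \<open>real n \<ge> 15\<close> show False by (simp add: power2_eq_square algebra_simps)
  qed
  with n consider "n = 3" | "n = 4" | "n = 6" | "n = 12" | "n = 13" | "n = 14" by force
  then show ?thesis
  proof cases
    case 1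
    then have "m \<le> 3" using \<open>m dvd n\<close> by (auto dest: dvd_imp_le)
    then have "m \<in> {2, 3}" using \<open>m \<ge> 2\<close> by auto
    then show ?thesis using 1 \<open>m dvd n\<close> by auto
  next
    case 2
    then have "m \<le> 4" using \<open>m dvd n\<close> by (auto dest: dvd_imp_le)
    then have "m \<in> {2, 3, 4}" using \<open>m \<ge> 2\<close> by auto
    then show ?thesis using 2 \<open>m dvd n\<close> by auto
  next
    case 3
    then have "m \<le> 6" using \<open>m dvd n\<close> by (auto dest: dvd_imp_le)
    then have "m \<in> {2, 3, 4, 5, 6}" using \<open>m \<ge> 2\<close> by auto
    then show ?thesis using 3 \<open>m dvd n\<close> by auto
  next
    case n: 4
    have "m < 4"
    proof (rule ccontr)
      assume "\<not> m < 4"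
      then have "(4::real)\<^sup>2 \<le> (real m)\<^sup>2" by (intro power_mono) auto
      then have "1 \<le> (1/16) * (real m)\<^sup>2" by simp
      from factor[OF this] n show False by simp
    qed
    then have "m \<in> {2, 3}" using \<open>m \<ge> 2\<close> by auto
    then show ?thesis using n by auto
  next
    case n: 5
    have "m < 4"
    proof (rule ccontr)
      assume "\<not> m < 4"
      then have "(4::real)\<^sup>2 \<le> (real m)\<^sup>2" by (intro power_mono) auto
      then have "1 \<le> (1/16) * (real m)\<^sup>2" by simp
      from factor[OF this] n show False by simp
    qed
    then have "m \<in> {2, 3}" using \<open>m \<ge> 2\<close> by auto
    then show ?thesis using n \<open>m dvd n\<close> by auto
  next
    case n: 6
    have "m < 4"
    proof (rule ccontr)
      assume "\<not> m < 4"
      then have "(4::real)\<^sup>2 \<le> (real m)\<^sup>2" by (intro power_mono) auto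
      then have "1 \<le> (1/16) * (real m)\<^sup>2" by simp
      from factor[OF this] n show False by simp
    qed
    then have "m \<in> {2, 3}" using \<open>m \<ge> 2\<close> by auto
    then show ?thesis using n \<open>m dvd n\<close> by auto
  qed
qed

section \<open>Vectors of the dual lattice\<close>

lemma int_subgroup_generator:
  fixes I :: "int set"
  assumes "n \<in> I" "n > 0" and diff: "\<And>x y. x \<in> I \<Longrightarrow> y \<in> I \<Longrightarrow> x - y \<in> I"
  obtains d where "d > 0" "d \<in> I" "\<And>x. x \<in> I \<Longrightarrow> d dvd x"
proof -
  define k where "k = (LEAST k::nat. k > 0 \<and> int k \<in> I)"
  have ex: "nat n > 0 \<and> int (nat n) \<in> I" using assms by simp
  have k: "k > 0" "int k \<in> I" using LeastI[of "\<lambda>k. k > 0 \<and> int k \<in> I", OF ex] by (auto simp: k_def)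
  have least: "k \<le> j" if "j > 0" "int j \<in> I" for j
    unfolding k_def using that by (intro Least_le) simp
  have zero: "0 \<in> I" using diff[OF \<open>n \<in> I\<close> \<open>n \<in> I\<close>] by simp
  have neg: "- x \<in> I" if "x \<in> I" for x using diff[OF zero that] by simp
  have add: "x + y \<in> I" if "x \<in> I" "y \<in> I" for x y using diff[OF that(1) neg[OF that(2)]] by simp
  have natmult: "int j * int k \<in> I" for j
    by (induction j) (auto simp: zero algebra_simps intro: add k)
  have mult: "z * int k \<in> I" for z
  proof (cases "z \<ge> 0")
    case True
    then show ?thesis using natmult[of "nat z"] by simp
  next
    case False
    then show ?thesis using neg[OF natmult[of "nat (- z)"]] by simp
  qed
  have "int k dvd x" if "x \<in> I" for x
  proof (rule ccontr)
    assume "\<not> int k dvd x"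
    then have "x mod int k \<noteq> 0" by (simp add: dvd_eq_mod_eq_0)
    then have pos: "x mod int k > 0" using pos_mod_sign[of "int k" x] k by linarith
    have "x mod int k \<in> I" using diff[OF that mult[of "x div int k"]] by (simp add: minus_div_mult_eq_mod)
    then have "k \<le> nat (x mod int k)" using pos by (intro least) auto
    moreover have "x mod int k < int k" using k by simp
    ultimately show False using pos by (simp add: le_nat_iff)
  qed
  with k show ?thesis using that[of "int k"] by simp
qed

context comm_group
begin

text \<open>
  Modulo \<open>\<int>\<close>, \<open>f - f \<one>\<close> is a character. Its order is \<open>m\<close> and \<open>a\<^sub>0\<close> is mapped to \<open>1/m\<close>, so that the
  translates by powers of \<open>a\<^sub>0\<close> run through all residues.
\<close>

lemma reduced_character:
  fixes f :: "'a \<Rightarrow> real"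
  assumes fin: "finite (carrier G)"
    and hom: "\<And>a b. a \<in> carrier G \<Longrightarrow> b \<in> carrier G \<Longrightarrow> f (a \<otimes> b) + f \<one> - f a - f b \<in> \<int>"
  obtains m :: nat and u :: "'a \<Rightarrow> int" and a\<^sub>0
  where "m dvd order G" "m > 0" "a\<^sub>0 \<in> carrier G"
    and "\<And>a. a \<in> carrier G \<Longrightarrow> f a = f \<one> + real_of_int (u a) / real m"
    and "\<And>a b. a \<in> carrier G \<Longrightarrow> b \<in> carrier G \<Longrightarrow> int m dvd u (a \<otimes> b) - u a - u b"
    and "int m dvd u a\<^sub>0 - 1"
proof -
  define n where "n = order G"
  have n: "n > 0" using fin by (simp add: n_def order_gt_0_iff_finite)
  define h where "h a = f a - f \<one>" for a
  have h: "h (a \<otimes> b) - h a - h b \<in> \<int>" if "a \<in> carrier G" "b \<in> carrier G" for a b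
    using hom[OF that] by (simp add: h_def algebra_simps)
  have pow: "h (a [^] k) - real k * h a \<in> \<int>" if a: "a \<in> carrier G" for a and k :: nat
  proof (induction k)
    case 0
    then show ?case by (simp add: h_def)
  next
    case (Suc k)
    have "h (a [^] Suc k) - real (Suc k) * h a =
        (h (a [^] k \<otimes> a) - h (a [^] k) - h a) + (h (a [^] k) - real k * h a)"
      by (simp add: algebra_simps)
    moreover have "(h (a [^] k \<otimes> a) - h (a [^] k) - h a) + (h (a [^] k) - real k * h a) \<in> \<int>"
      using Suc h[of "a [^] k" a] a by (intro Ints_add) auto
    ultimately show ?case by (simp only:)
  qed
  have "\<exists>z. real n * h a = real_of_int z" if a: "a \<in> carrier G" for a
  proof -
    have "a [^] n = \<one>" using power_order_eq_one[OF fin a] by (simp add: n_def order_def)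
    with pow[OF a, of n] have "real n * h a \<in> \<int>" by (simp add: h_def)
    then show ?thesis by (auto elim: Ints_cases)
  qed
  then obtain U where U: "real n * h a = real_of_int (U a)" if "a \<in> carrier G" for a by metis
  have Uadd: "int n dvd U (a \<otimes> b) - U a - U b" if "a \<in> carrier G" "b \<in> carrier G" for a b
  proof -
    obtain z where z: "h (a \<otimes> b) - h a - h b = real_of_int z"
      using h[OF \<open>a \<in> carrier G\<close> \<open>b \<in> carrier G\<close>] by (auto elim: Ints_cases)
    have "real_of_int (U (a \<otimes> b) - U a - U b) = real n * h (a \<otimes> b) - real n * h a - real n * h b"
      using U[OF that(1)] U[OF that(2)] U[of "a \<otimes> b"] that by simp
    also have "\<dots> = real n * (h (a \<otimes> b) - h a - h b)" by (simp add: right_diff_distrib)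
    also have "\<dots> = real_of_int (int n * z)" using z by simp
    finally show ?thesis by (simp only: of_int_eq_iff) simp
  qed
  have U1: "U \<one> = 0" using U[of \<one>] by (simp add: h_def)
  \<comment> \<open>\<open>I\<close> consists of the values of \<open>U\<close> and their translates
    by multiples of \<open>n\<close>. Modulo \<open>n\<close> it is the image of a homomorphism, so
    it is a subgroup of the integers without sums of values having to be added. Its generator
    \<open>d\<close> is therefore itself congruent to some \<open>U a0\<close>, and this
    \<open>a0\<close> is the element mapped to \<open>1/m\<close>, where
    \<open>m = n/d\<close>.\<close>
  define I where "I = {x. \<exists>a\<in>carrier G. int n dvd x - U a}"
  have "int n \<in> I" unfolding I_def using U1 by (intro CollectI bexI[of _ \<one>]) auto
  moreover have "x - y \<in> I" if xy: "x \<in> I" "y \<in> I" for x y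
  proof -
    obtain a b where a: "a \<in> carrier G" "int n dvd x - U a" and b: "b \<in> carrier G" "int n dvd y - U b"
      using xy by (auto simp: I_def)
    have "int n dvd U (a \<otimes> inv b \<otimes> b) - U (a \<otimes> inv b) - U b" using a b by (intro Uadd) auto
    moreover have "a \<otimes> inv b \<otimes> b = a" using a b by (simp add: m_assoc)
    ultimately have "int n dvd (x - U a) - (y - U b) + (U a - U (a \<otimes> inv b) - U b)"
      using a b by (metis dvd_add dvd_diff)
    then have "int n dvd x - y - U (a \<otimes> inv b)" by (simp add: algebra_simps)
    then show ?thesis unfolding I_def using a b by (intro CollectI bexI[of _ "a \<otimes> inv b"]) auto
  qed
  ultimately obtain d where d: "d > 0" "d \<in> I" "\<And>x. x \<in> I \<Longrightarrow> d dvd x"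
    using int_subgroup_generator[of "int n" I] n by auto
  have "d dvd int n" using d(3) \<open>int n \<in> I\<close> .
  define m where "m = nat (int n div d)"
  have dm: "int n = d * int m" using \<open>d dvd int n\<close> d n by (simp add: m_def pos_imp_zdiv_nonneg_iff)
  then have dm': "real n = real_of_int d * real m" by (metis of_int_mult of_int_of_nat_eq)
  have "m > 0" using dm n by (cases m) auto
  have dU: "d dvd U a" if "a \<in> carrier G" for a
    using that by (intro d(3)) (auto simp: I_def intro!: bexI[of _ a])
  define u where "u a = U a div d" for a
  have u: "U a = d * u a" if "a \<in> carrier G" for a using dU[OF that] by (simp add: u_def)
  obtain a0 where a0: "a0 \<in> carrier G" "int n dvd d - U a0" using d(2) by (auto simp: I_def)
  show ?thesis
  proof (rule that[of m a0 u])
    show "m dvd order G" using dm by (metis dvd_triv_right n_def of_nat_dvd_iff)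
    show "f a = f \<one> + real_of_int (u a) / real m" if "a \<in> carrier G" for a
    proof -
      have "real_of_int d * real m * h a = real_of_int d * real_of_int (u a)"
        using U[OF that] u[OF that] dm' by simp
      then have "real m * h a = real_of_int (u a)" using d(1) by simp
      then show ?thesis using \<open>m > 0\<close> by (simp add: h_def field_simps)
    qed
    show "int m dvd u (a \<otimes> b) - u a - u b" if "a \<in> carrier G" "b \<in> carrier G" for a b
    proof -
      have "d * int m dvd d * (u (a \<otimes> b) - u a - u b)"
        using Uadd[OF that] u that dm by (simp add: right_diff_distrib)
      then show ?thesis using d(1) by simp
    qed
    have "d * int m dvd d * (1 - u a0)" using a0 u dm by (simp add: right_diff_distrib)
    then have "int m dvd 1 - u a0" using d(1) by simp
    then show "int m dvd u a0 - 1" by (simp add: dvd_diff_commute)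
  qed (use a0 \<open>m > 0\<close> in auto)
qed

lemma sum_translate:
  fixes F :: "'a \<Rightarrow> 'c::comm_monoid_add"
  assumes "c \<in> carrier G"
  shows "(\<Sum>a\<in>carrier G. F (a \<otimes> c)) = (\<Sum>a\<in>carrier G. F a)"
proof (rule sum.reindex_bij_witness[of _ "\<lambda>a. a \<otimes> inv c" "\<lambda>a. a \<otimes> c"])
qed (use assms in \<open>auto simp: m_assoc\<close>)

text \<open>Every power of \<open>c\<close> permutes the group by translation. A claim about the
  \<open>m\<close> terms \<open>a, a c, ..., a c^(m-1)\<close> can thus be summed over the group
  without choosing coset representatives, and \<open>m\<close> may differ from the order of
  \<open>c\<close>.\<close>

lemma sum_average_powers:
  fixes F :: "'a \<Rightarrow> 'c::comm_semiring_1"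
  assumes "c \<in> carrier G"
  shows "(\<Sum>a\<in>carrier G. \<Sum>k<m. F (a \<otimes> c [^] (k::nat))) = of_nat m * (\<Sum>a\<in>carrier G. F a)"
  using assms by (subst sum.swap) (simp add: sum_translate)

lemma minimal_dual_vector:
  fixes f :: "'a \<Rightarrow> real"
  assumes fin: "finite (carrier G)" and n: "order G = n" "n \<in> {3, 4, 6} \<or> n \<ge> 12"
    and hom: "\<And>a b. a \<in> carrier G \<Longrightarrow> b \<in> carrier G \<Longrightarrow> f (a \<otimes> b) + f \<one> - f a - f b \<in> \<int>"
    and sum0: "(\<Sum>a\<in>carrier G. f a) = 0"
    and norm: "(\<Sum>a\<in>carrier G. (f a)\<^sup>2) = 1 - 1 / real n"
  obtains c s where "c \<in> carrier G" "s = 1 \<or> s = -1"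
    "\<And>a. a \<in> carrier G \<Longrightarrow> f a = s * ((if a = c then 1 else 0) - 1 / real n)"
proof -
  have card: "card (carrier G) = n" using n by (simp add: order_def)
  have npos: "real n > 0" using n by auto
  obtain m u a0 where m: "m dvd n" "m > 0" and a0: "a0 \<in> carrier G"
    and fu': "\<And>a. a \<in> carrier G \<Longrightarrow> f a = f \<one> + real_of_int (u a) / real m"
    and uadd: "\<And>a b. a \<in> carrier G \<Longrightarrow> b \<in> carrier G \<Longrightarrow> int m dvd u (a \<otimes> b) - u a - u b"
    and u0: "int m dvd u a0 - 1"
    using reduced_character[OF fin hom] n by metis
  define e where "e = f \<one>"
  have fu: "f a = e + real_of_int (u a) / real m" if "a \<in> carrier G" for a
    unfolding e_def using that by (rule fu')
  define S where "S = (\<Sum>a\<in>carrier G. u a)"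
  define Q where "Q = (\<Sum>a\<in>carrier G. (u a)\<^sup>2)"
  have S: "(\<Sum>a\<in>carrier G. real_of_int (u a)) = real_of_int S" by (simp add: S_def)
  have Q: "(\<Sum>a\<in>carrier G. (real_of_int (u a))\<^sup>2) = real_of_int Q" by (simp add: Q_def)
  have f1: "real n * e + real_of_int S / real m = 0"
  proof -
    have "(\<Sum>a\<in>carrier G. f a) = (\<Sum>a\<in>carrier G. e + real_of_int (u a) / real m)"
      by (rule sum.cong) (use fu in auto)
    then show ?thesis using sum0 by (simp add: sum.distrib card S flip: sum_divide_distrib)
  qed
  have dev: "(\<Sum>a\<in>carrier G. (real_of_int (u a) - real_of_int S / real n)\<^sup>2) = (real m)\<^sup>2 * (1 - 1 / real n)"
  proof -
    have "real_of_int (u a) - real_of_int S / real n = real m * f a" if "a \<in> carrier G" for a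
      using f1 fu[OF that] m npos by (simp add: field_simps)
    then have "(\<Sum>a\<in>carrier G. (real_of_int (u a) - real_of_int S / real n)\<^sup>2) = (\<Sum>a\<in>carrier G. (real m * f a)\<^sup>2)"
      by (intro sum.cong) auto
    then show ?thesis by (simp add: power_mult_distrib norm flip: sum_distrib_left)
  qed
  have dev': "(\<Sum>a\<in>carrier G. (real_of_int (u a) - real_of_int S / real n)\<^sup>2)
      = real_of_int Q - (real_of_int S)\<^sup>2 / real n"
  proof -
    have "(\<Sum>a\<in>carrier G. (real_of_int (u a) - t)\<^sup>2)
        = real_of_int Q - 2 * t * real_of_int S + real n * t\<^sup>2" for t
    proof -
      have "(\<Sum>a\<in>carrier G. (real_of_int (u a) - t)\<^sup>2) =
          (\<Sum>a\<in>carrier G. (real_of_int (u a))\<^sup>2 - 2 * t * real_of_int (u a) + t\<^sup>2)"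
        by (simp add: power2_diff algebra_simps)
      then show ?thesis
        by (simp add: sum.distrib sum_subtractf card Q flip: sum_distrib_left S)
    qed
    from this[of "real_of_int S / real n"]
    have "(\<Sum>a\<in>carrier G. (real_of_int (u a) - real_of_int S / real n)\<^sup>2) =
        real_of_int Q - 2 * (real_of_int S / real n) * real_of_int S + real n * (real_of_int S / real n)\<^sup>2" .
    also have "\<dots> = real_of_int Q - (real_of_int S)\<^sup>2 / real n"
      using npos by (simp add: field_simps power2_eq_square)
    finally show ?thesis .
  qed
  \<comment> \<open>The sum condition gives \<open>m * f a = u a - S/n\<close>, so the unknown
    translation \<open>f \<one>\<close> drops out and the norm condition becomes an equation between
    integers.\<close>
  have var: "int n * Q - S\<^sup>2 = (int m)\<^sup>2 * (int n - 1)"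
  proof -
    have "real_of_int (int n * Q - S\<^sup>2) = real_of_int ((int m)\<^sup>2 * (int n - 1))"
      using dev dev' npos by (simp add: field_simps)
    then show ?thesis by (simp only: of_int_eq_iff)
  qed
  have upow: "int m dvd u (a \<otimes> a0 [^] k) - u a - int k" if a: "a \<in> carrier G" for a and k :: nat
  proof (induction k)
    case 0
    then show ?case using a by simp
  next
    case (Suc k)
    have "a \<otimes> a0 [^] Suc k = (a \<otimes> a0 [^] k) \<otimes> a0" using a a0 by (simp add: m_assoc)
    then have "u (a \<otimes> a0 [^] Suc k) - u a - int (Suc k) =
       (u (a \<otimes> a0 [^] k \<otimes> a0) - u (a \<otimes> a0 [^] k) - u a0) + (u (a \<otimes> a0 [^] k) - u a - int k) + (u a0 - 1)"
      by simp
    moreover have "int m dvd (u (a \<otimes> a0 [^] k \<otimes> a0) - u (a \<otimes> a0 [^] k) - u a0)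
        + (u (a \<otimes> a0 [^] k) - u a - int k) + (u a0 - 1)"
      using Suc uadd[of "a \<otimes> a0 [^] k" a0] a a0 u0 by (intro dvd_add) auto
    ultimately show ?case by (simp only:)
  qed
  \<comment> \<open>The \<open>m\<close> values have distinct residues. So they are distinct
    integers, as the deviation bound requires, and they hit every residue once, as the congruences
    require.\<close>
  have inj: "inj_on (\<lambda>k. u (a \<otimes> a0 [^] k) mod int m) {..<m}" if a: "a \<in> carrier G" for a
  proof (rule inj_onI)
    fix j k :: nat assume jk: "j \<in> {..<m}" "k \<in> {..<m}"
      and eq: "u (a \<otimes> a0 [^] j) mod int m = u (a \<otimes> a0 [^] k) mod int m"
    have "int m dvd u (a \<otimes> a0 [^] j) - u (a \<otimes> a0 [^] k)" using eq by (simp add: mod_eq_dvd_iff)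
    then have "int m dvd (u (a \<otimes> a0 [^] j) - u (a \<otimes> a0 [^] k))
        - (u (a \<otimes> a0 [^] j) - u a - int j) + (u (a \<otimes> a0 [^] k) - u a - int k)"
      by (rule dvd_add[OF dvd_diff[OF _ upow[OF a]] upow[OF a]])
    then have "int m dvd int j - int k" by simp
    then have "int j mod int m = int k mod int m" by (simp add: mod_eq_dvd_iff)
    then show "j = k" using jk by simp
  qed
  show ?thesis
  proof (cases "m = 1")
    case True
    have "int n * (\<Sum>a\<in>carrier G. (u a)\<^sup>2) - (\<Sum>a\<in>carrier G. u a)\<^sup>2 = int n - 1"
      using var True by (simp add: S_def Q_def)
    moreover have "n \<ge> 3" using n by auto
    ultimately obtain c k s where c: "c \<in> carrier G" and s: "s = 1 \<or> s = -1"
      and uk: "\<And>a. a \<in> carrier G \<Longrightarrow> u a = k + (if a = c then s else 0)"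
      using near_constant_of_variance[OF fin card] by metis
    have "S = (\<Sum>a\<in>carrier G. k + (if a = c then s else 0))"
      unfolding S_def by (rule sum.cong) (use uk in auto)
    then have "S = int n * k + s" using c fin by (simp add: sum.distrib card)
    then have "real n * (e + real_of_int k) = - real_of_int s"
      using f1 True by (simp add: algebra_simps)
    then have f1k: "e + real_of_int k = - real_of_int s / real n" using npos by (simp add: field_simps)
    show ?thesis
    proof (rule that[of c "real_of_int s"])
      show "f a = real_of_int s * ((if a = c then 1 else 0) - 1 / real n)" if "a \<in> carrier G" for a
        using fu[OF that] uk[OF that] f1k True by (auto simp: algebra_simps)
    qed (use c s in auto)
  next
    case False
    then have "m \<ge> 2" using m by simp
    define c where "c = real_of_int S / real n"
    have each: "real m * ((real m)\<^sup>2 - 1) / 12 \<le> (\<Sum>k<m. (real_of_int (u (a \<otimes> a0 [^] k)) - c)\<^sup>2)"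
      if a: "a \<in> carrier G" for a
    proof -
      have inj': "inj_on (\<lambda>k. u (a \<otimes> a0 [^] k)) {..<m}" using inj[OF a] by (auto simp: inj_on_def)
      have "(\<Sum>k<m. (real_of_int (u (a \<otimes> a0 [^] k)) - c)\<^sup>2)
          = (\<Sum>y\<in>(\<lambda>k. u (a \<otimes> a0 [^] k)) ` {..<m}. (real_of_int y - c)\<^sup>2)"
        using inj' by (simp add: sum.reindex)
      then show ?thesis
        using sum_square_deviation_ge[of "(\<lambda>k. u (a \<otimes> a0 [^] k)) ` {..<m}" c] inj' by (simp add: card_image)
    qed
    have "real m * (real n * (((real m)\<^sup>2 - 1) / 12)) \<le> real m * (\<Sum>a\<in>carrier G. (real_of_int (u a) - c)\<^sup>2)"
    proof -
      have "real m * (real n * (((real m)\<^sup>2 - 1) / 12)) = (\<Sum>a\<in>carrier G. real m * ((real m)\<^sup>2 - 1) / 12)"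
        by (simp add: card mult_ac)
      also have "\<dots> \<le> (\<Sum>a\<in>carrier G. \<Sum>k<m. (real_of_int (u (a \<otimes> a0 [^] k)) - c)\<^sup>2)"
        using each by (intro sum_mono)
      also have "\<dots> = real m * (\<Sum>a\<in>carrier G. (real_of_int (u a) - c)\<^sup>2)"
        using a0 by (rule sum_average_powers)
      finally show ?thesis .
    qed
    also have "\<dots> = real m * ((real m)\<^sup>2 * (1 - 1 / real n))" using dev by (simp add: c_def)
    finally have "real n * (((real m)\<^sup>2 - 1) / 12) \<le> (real m)\<^sup>2 * (1 - 1 / real n)"
      using m by (simp only: mult_le_cancel_left_pos of_nat_0_less_iff)
    then have "real n * (real n * (((real m)\<^sup>2 - 1) / 12)) \<le> real n * ((real m)\<^sup>2 * (1 - 1 / real n))"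
      using npos by (intro mult_left_mono) auto
    moreover have "real n * ((real m)\<^sup>2 * (1 - 1 / real n)) = (real m)\<^sup>2 * (real n - 1)"
      using npos by (simp add: field_simps)
    moreover have "(real n)\<^sup>2 * ((real m)\<^sup>2 - 1) = 12 * (real n * (real n * (((real m)\<^sup>2 - 1) / 12)))"
      by (simp add: power2_eq_square)
    ultimately have le: "(real n)\<^sup>2 * ((real m)\<^sup>2 - 1) \<le> 12 * ((real m)\<^sup>2 * (real n - 1))"
      by (simp only: mult_le_cancel_left_pos zero_less_numeral)
    have equi: "int m * (\<Sum>a\<in>carrier G. \<phi> (u a mod int m)) = int n * (\<Sum>k<m. \<phi> (int k))" for \<phi> :: "int \<Rightarrow> int"
    proof -
      have "(\<Sum>k<m. \<phi> (u (a \<otimes> a0 [^] k) mod int m)) = (\<Sum>k<m. \<phi> (int k))" if a: "a \<in> carrier G" for a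
      proof -
        have img: "(\<lambda>k. u (a \<otimes> a0 [^] k) mod int m) ` {..<m} = int ` {..<m}"
        proof (rule card_subset_eq)
          show "(\<lambda>k. u (a \<otimes> a0 [^] k) mod int m) ` {..<m} \<subseteq> int ` {..<m}"
          proof
            fix y assume "y \<in> (\<lambda>k. u (a \<otimes> a0 [^] k) mod int m) ` {..<m}"
            then have "0 \<le> y" "y < int m" using m by auto
            then show "y \<in> int ` {..<m}" by (intro image_eqI[of _ _ "nat y"]) auto
          qed
          show "card ((\<lambda>k. u (a \<otimes> a0 [^] k) mod int m) ` {..<m}) = card (int ` {..<m})"
            using inj[OF a] by (simp add: card_image inj_on_def)
        qed simp
        have "(\<Sum>k<m. \<phi> (u (a \<otimes> a0 [^] k) mod int m)) = sum \<phi> ((\<lambda>k. u (a \<otimes> a0 [^] k) mod int m) ` {..<m})"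
          using inj[OF a] by (simp add: sum.reindex)
        also have "\<dots> = (\<Sum>k<m. \<phi> (int k))" unfolding img by (simp add: sum.reindex)
        finally show ?thesis .
      qed
      then have "(\<Sum>a\<in>carrier G. \<Sum>k<m. \<phi> (u (a \<otimes> a0 [^] k) mod int m)) = int n * (\<Sum>k<m. \<phi> (int k))"
        by (simp add: card)
      then show ?thesis using sum_average_powers[OF a0, where F = "\<lambda>a. \<phi> (u a mod int m)" and m = m] by simp
    qed
    have "(n, m) \<in> {(3,3),(4,2),(4,4),(6,2),(6,3),(6,6),(12,2),(12,3),(14,2)}"
      using equidistributed_variance_bound[OF m(1) \<open>m \<ge> 2\<close> n(2) le] .
    from equidistributed_variance_neq[OF fin this equi] var show ?thesis
      by (simp add: S_def Q_def)
  qed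
qed

end

section \<open>Integer-valued functions on the group\<close>

lemma (in group) finprod_closed_subgroup:
  assumes "comm_group G" "subgroup H G" "f \<in> A \<rightarrow> H"
  shows "finprod G f A \<in> H"
proof -
  interpret comm_group G by fact
  interpret H: subgroup H G by fact
  show ?thesis using assms(3)
  proof (induction A rule: infinite_finite_induct)
    case (insert x F)
    then have "finprod G f (insert x F) = f x \<otimes> finprod G f F"
      using H.subset by (intro finprod_insert) auto
    then show ?case using insert by auto
  qed auto
qed

context comm_group
begin

lemma hom_finprod:
  assumes h: "h \<in> hom G G" and "f \<in> A \<rightarrow> carrier G"
  shows "h (finprod G f A) = finprod G (\<lambda>a. h (f a)) A"
  using assms(2)
proof (induction A rule: infinite_finite_induct)
  case (insert x F)
  have "h (finprod G f (insert x F)) = h (f x) \<otimes> h (finprod G f F)"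
    using insert h by (simp add: hom_mult)
  then show ?case using insert hom_in_carrier[OF h] by (simp add: Pi_iff)
qed (use h in \<open>auto simp: hom_one\<close>)

lemma finprod_int_pow_sum:
  assumes "t \<in> carrier G"
  shows "(\<Otimes>a\<in>A. t [^] (x a :: int)) = t [^] (\<Sum>a\<in>A. x a)"
proof (induction A rule: infinite_finite_induct)
  case (insert a F)
  then show ?case using assms by (simp add: int_pow_mult)
qed auto

lemma finprod_inv:
  assumes "f \<in> A \<rightarrow> carrier G"
  shows "(\<Otimes>a\<in>A. inv (f a)) = inv (finprod G f A)"
  using assms
proof (induction A rule: infinite_finite_induct)
  case (insert x F)
  then show ?case by (simp add: inv_mult Pi_iff)
qed auto

lemma finprod_int_pow_base:
  assumes "f \<in> A \<rightarrow> carrier G"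
  shows "(\<Otimes>a\<in>A. f a [^] (k::int)) = finprod G f A [^] k"
  using assms
proof (induction A rule: infinite_finite_induct)
  case (insert x F)
  then show ?case by (simp add: int_pow_distrib Pi_iff)
qed auto

lemma finprod_reindex_bij:
  assumes "bij_betw h A B" "f \<in> B \<rightarrow> carrier G"
  shows "finprod G f B = (\<Otimes>x\<in>A. f (h x))"
  using finprod_reindex[of f h A] assms by (auto simp: bij_betw_def)

text \<open>The product runs over all of \<open>carrier G\<close>, since the factor at the neutral
  element is trivial; \<open>weight_index\<close> compares it with the product in
  \<open>group_lattice\<close>. Functions on the group replace vectors because group elements are to
  act on the coordinates.\<close>

definition weight :: "('a \<Rightarrow> int) \<Rightarrow> 'a" where
  "weight x = (\<Otimes>a\<in>carrier G. a [^] x a)"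

definition lattice_fun :: "('a \<Rightarrow> int) \<Rightarrow> bool" where
  "lattice_fun x \<longleftrightarrow> (\<Sum>a\<in>carrier G. x a) = 0 \<and> weight x = \<one>"

definition single :: "'a \<Rightarrow> 'a \<Rightarrow> int" where
  "single c a = (if a = c then 1 else 0)"

lemma weight_closed [simp]: "weight x \<in> carrier G"
  unfolding weight_def by (intro finprod_closed) auto

lemma weight_cong: "(\<And>a. a \<in> carrier G \<Longrightarrow> x a = y a) \<Longrightarrow> weight x = weight y"
  unfolding weight_def by (intro finprod_cong') auto

lemma weight_add: "weight (\<lambda>a. x a + y a) = weight x \<otimes> weight y"
proof -
  have "weight (\<lambda>a. x a + y a) = (\<Otimes>a\<in>carrier G. a [^] x a \<otimes> a [^] y a)"
    unfolding weight_def by (intro finprod_cong') (auto simp: int_pow_mult)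
  then show ?thesis unfolding weight_def by (simp add: finprod_multf Pi_iff)
qed

lemma weight_scale: "weight (\<lambda>a. k * x a) = weight x [^] k"
proof -
  have "weight (\<lambda>a. k * x a) = (\<Otimes>a\<in>carrier G. (a [^] x a) [^] k)"
    unfolding weight_def by (intro finprod_cong') (auto simp: int_pow_pow mult.commute)
  then show ?thesis unfolding weight_def by (simp add: finprod_int_pow_base Pi_iff)
qed

lemma weight_minus: "weight (\<lambda>a. - x a) = inv (weight x)"
  using weight_scale[of "-1" x] by (simp add: int_pow_neg)

lemma weight_single:
  assumes "finite (carrier G)" "c \<in> carrier G"
  shows "weight (single c) = c"
proof -
  have "weight (single c) = (\<Otimes>a\<in>carrier G. if c = a then a else \<one>)"
    unfolding weight_def single_def by (intro finprod_cong') auto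
  then show ?thesis using finprod_singleton[of c "carrier G" "\<lambda>a. a"] assms by (simp add: Pi_iff)
qed

lemma sum_single:
  assumes "finite (carrier G)" "c \<in> carrier G"
  shows "(\<Sum>a\<in>carrier G. single c a) = 1"
  using assms by (simp add: single_def)

text \<open>The order of the group annihilates every weight. These vectors span (see
  \<open>span_lattice\<close>) and serve as test vectors with at most two nonzero
  coordinates.\<close>

lemma lattice_fun_diff_single:
  assumes "finite (carrier G)" "a \<in> carrier G" "b \<in> carrier G"
  shows "lattice_fun (\<lambda>c. int (order G) * (single a c - single b c))"
proof -
  have "weight (\<lambda>c. single a c + - single b c) = a \<otimes> inv b"
    using assms by (simp only: weight_add weight_minus weight_single)
  then have "weight (\<lambda>c. int (order G) * (single a c - single b c)) = (a \<otimes> inv b) [^] int (order G)"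
    unfolding weight_scale by simp
  then have "weight (\<lambda>c. int (order G) * (single a c - single b c)) = \<one>"
    using assms power_order_eq_one[of "a \<otimes> inv b"] by (simp add: int_pow_int order_def)
  then show ?thesis
    using assms by (simp add: lattice_fun_def sum_subtractf sum_single flip: sum_distrib_left)
qed

text \<open>The four positions may coincide. From right to left this yields the lattice vectors e_ab
  + e_1 - e_a - e_b; from left to right it turns the membership of their images into an identity in
  the group.\<close>

lemma lattice_fun_relation:
  assumes "finite (carrier G)" "a \<in> carrier G" "b \<in> carrier G" "c \<in> carrier G" "d \<in> carrier G"
  shows "lattice_fun (\<lambda>y. single a y + single b y + - single c y + - single d y) \<longleftrightarrow> a \<otimes> b = c \<otimes> d"
proof -
  have "weight (\<lambda>y. single a y + single b y + - single c y + - single d y) = a \<otimes> b \<otimes> inv c \<otimes> inv d"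
    using assms by (simp only: weight_add weight_minus weight_single)
  also have "\<dots> = a \<otimes> b \<otimes> inv (c \<otimes> d)" using assms by (simp add: m_assoc inv_mult)
  also have "\<dots> = \<one> \<longleftrightarrow> a \<otimes> b = c \<otimes> d"
    using assms by (metis inv_closed inv_equality inv_inv m_closed r_inv)
  finally show ?thesis
    using assms by (simp add: lattice_fun_def sum.distrib sum_subtractf sum_single)
qed

end

section \<open>Isometries of a lattice of integer vectors\<close>

lemma finite_bounded_integer_vectors:
  "finite {x :: real ^ 'n::finite. \<forall>i. x $ i \<in> \<int> \<and> \<bar>x $ i\<bar> \<le> r}"
proof -
  let ?S = "real_of_int ` {- \<lfloor>r\<rfloor> .. \<lfloor>r\<rfloor>}"
  have "x \<in> (\<lambda>f. \<chi> i. f i) ` (UNIV \<rightarrow>\<^sub>E ?S)" if x: "\<forall>i. x $ i \<in> \<int> \<and> \<bar>x $ i\<bar> \<le> r" for x :: "real ^ 'n"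
  proof (rule image_eqI[of _ _ "\<lambda>i. x $ i"])
    have "x $ i \<in> ?S" for i
    proof -
      obtain z where z: "x $ i = real_of_int z" using x by (auto elim: Ints_cases)
      then have "\<bar>real_of_int z\<bar> \<le> r" using x by metis
      then have "z \<le> \<lfloor>r\<rfloor>" "- z \<le> \<lfloor>r\<rfloor>" by (auto simp: le_floor_iff)
      then show ?thesis using z by auto
    qed
    then show "(\<lambda>i. x $ i) \<in> UNIV \<rightarrow>\<^sub>E ?S" by auto
  qed simp
  then have "{x :: real ^ 'n. \<forall>i. x $ i \<in> \<int> \<and> \<bar>x $ i\<bar> \<le> r} \<subseteq> (\<lambda>f. \<chi> i. f i) ` (UNIV \<rightarrow>\<^sub>E ?S)"
    by blast
  then show ?thesis by (rule finite_subset) (intro finite_imageI finite_PiE, auto)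
qed

text \<open>That \<open>T\<close> maps \<open>L\<close> onto itself follows from finiteness: there
  are only finitely many integer vectors of a given norm, and \<open>T\<close> maps those in
  \<open>L\<close> injectively to themselves. Preservation of the inner product comes from that of
  the norm by polarization.\<close>

lemma isometry_lattice_auto:
  fixes T :: "real ^ 'n::finite \<Rightarrow> real ^ 'n"
  assumes lin: "linear T" and iso: "\<And>w. w \<in> span L \<Longrightarrow> norm (T w) = norm w"
    and sub: "T ` L \<subseteq> L" and int: "\<And>x i. x \<in> L \<Longrightarrow> x $ i \<in> \<int>"
  shows "restrict T (span L) \<in> lattice_auto L"
proof -
  have inj: "inj_on T (span L)"
  proof (rule inj_onI)
    fix x y assume xy: "x \<in> span L" "y \<in> span L" "T x = T y"
    then have "norm (T (x - y)) = 0" using lin by (simp add: linear_diff)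
    then show "x = y" using iso[of "x - y"] xy by (simp add: span_diff)
  qed
  have onto: "T ` L = L"
  proof (intro equalityI sub subsetI)
    fix x assume x: "x \<in> L"
    define S where "S = {y \<in> L. norm y = norm x}"
    have "S \<subseteq> {y. \<forall>i. y $ i \<in> \<int> \<and> \<bar>y $ i\<bar> \<le> norm x}"
    proof (intro subsetI CollectI allI)
      fix y i assume "y \<in> S"
      then show "y $ i \<in> \<int> \<and> \<bar>y $ i\<bar> \<le> norm x"
        using int component_le_norm_cart[of y i] by (simp add: S_def)
    qed
    then have "finite S" by (rule finite_subset) (rule finite_bounded_integer_vectors)
    moreover have "T ` S \<subseteq> S" using sub iso by (auto simp: S_def span_base)
    moreover have "inj_on T S" using inj by (rule inj_on_subset) (auto simp: S_def span_base)
    ultimately have "T ` S = S" by (rule endo_inj_surj)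
    moreover have "x \<in> S" using x by (simp add: S_def)
    ultimately show "x \<in> T ` L" by (auto simp: S_def)
  qed
  have span: "T ` span L = span L" using linear_span_image[OF lin, of L] onto by simp
  have closed: "T w \<in> span L" if "w \<in> span L" for w using span that by blast
  have inner: "T v \<bullet> T w = v \<bullet> w" if "v \<in> span L" "w \<in> span L" for v w
  proof -
    have "norm (T (v + w)) = norm (v + w)" using iso[of "v + w"] that by (simp add: span_add)
    then have "(T v + T w) \<bullet> (T v + T w) = (v + w) \<bullet> (v + w)"
      using lin by (simp add: linear_add norm_eq)
    moreover have "T v \<bullet> T v = v \<bullet> v" "T w \<bullet> T w = w \<bullet> w" using iso that by (simp_all add: norm_eq)
    ultimately show ?thesis by (simp add: inner_simps inner_commute)
  qed
  have "restrict T (span L) \<in> Bij (span L)"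
    using inj span by (auto simp: Bij_def bij_betw_def inj_on_def)
  moreover have "restrict T (span L) ` L = T ` L" by (rule image_cong) (simp_all add: span_base)
  ultimately show ?thesis
    using lin closed inner onto
    by (auto simp: lattice_auto_def orthogonal_maps_on_def span_add span_scale linear_add linear_scale)
qed

section \<open>The action of the holomorph\<close>

locale indexed_abelian_group = comm_group G for G :: "('a, 'b) monoid_scheme" (structure) +
  fixes g :: "'n::finite \<Rightarrow> 'a" and i\<^sub>0 :: 'n
  assumes fin: "finite (carrier G)"
    and bij: "bij_betw g UNIV (carrier G)"
    and g_i\<^sub>0: "g i\<^sub>0 = \<one>"
begin

abbreviation "L \<equiv> group_lattice G g i\<^sub>0"
abbreviation "N \<equiv> order G"
abbreviation "C2Hol \<equiv> integer_mod_group 2 \<times>\<times> holomorph G"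

definition idx :: "'a \<Rightarrow> 'n" where "idx = inv_into UNIV g"
definition coord :: "real ^ 'n \<Rightarrow> 'a \<Rightarrow> real" where "coord w a = w $ idx a"
definition fvec :: "('a \<Rightarrow> real) \<Rightarrow> real ^ 'n" where "fvec F = (\<chi> i. F (g i))"

lemma g_closed [simp]: "g i \<in> carrier G"
  using bij by (auto simp: bij_betw_def)

lemma g_idx [simp]: "a \<in> carrier G \<Longrightarrow> g (idx a) = a"
  using bij unfolding idx_def by (simp add: bij_betw_def f_inv_into_f)

lemma idx_g [simp]: "idx (g i) = i"
  using bij unfolding idx_def by (simp add: bij_betw_def)

lemma coord_fvec [simp]: "a \<in> carrier G \<Longrightarrow> coord (fvec F) a = F a"
  by (simp add: coord_def fvec_def)

lemma vec_eqI:
  assumes "\<And>a. a \<in> carrier G \<Longrightarrow> coord u a = coord w a"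
  shows "u = w"
  unfolding vec_eq_iff using assms[of "g i" for i] by (simp add: coord_def)

lemma coord_add [simp]: "coord (u + w) a = coord u a + coord w a"
  and coord_diff [simp]: "coord (u - w) a = coord u a - coord w a"
  and coord_minus [simp]: "coord (- w) a = - coord w a"
  and coord_scaleR [simp]: "coord (r *\<^sub>R w) a = r * coord w a"
  and coord_zero [simp]: "coord 0 a = 0"
  by (simp_all add: coord_def)

lemma sum_index: "(\<Sum>i\<in>UNIV. F (g i)) = (\<Sum>a\<in>carrier G. F a)"
  using bij by (rule sum.reindex_bij_betw)

lemma inner_coord: "u \<bullet> w = (\<Sum>a\<in>carrier G. coord u a * coord w a)"
  using sum_index[of "\<lambda>a. coord u a * coord w a"] by (simp add: inner_vec_def coord_def)

lemma N_pos: "N > 0"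
  using fin by (simp add: order_gt_0_iff_finite)

lemma weight_index: "weight x = (\<Otimes>j\<in>UNIV - {i\<^sub>0}. g j [^] x (g j))"
proof -
  have "weight x = (\<Otimes>j\<in>UNIV. g j [^] x (g j))"
    unfolding weight_def using bij by (rule finprod_reindex_bij) auto
  also have "\<dots> = g i\<^sub>0 [^] x (g i\<^sub>0) \<otimes> (\<Otimes>j\<in>UNIV - {i\<^sub>0}. g j [^] x (g j))"
    by (subst finprod_insert[symmetric]) (auto simp: insert_absorb)
  finally show ?thesis by (simp add: g_i\<^sub>0 Pi_iff)
qed

lemma lattice_iff:
  "w \<in> L \<longleftrightarrow> (\<exists>x. lattice_fun x \<and> (\<forall>a\<in>carrier G. coord w a = real_of_int (x a)))"
proof
  assume "w \<in> L"
  then obtain x :: "int ^ 'n" where w: "w = (\<chi> i. real_of_int (x $ i))"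
    and "(\<Sum>i\<in>UNIV. x $ i) = 0" "(\<Otimes>j\<in>UNIV - {i\<^sub>0}. g j [^] (x $ j)) = \<one>"
    unfolding group_lattice_def by blast
  then have "lattice_fun (\<lambda>a. x $ idx a)"
    unfolding lattice_fun_def weight_index sum_index[symmetric] by simp
  moreover have "coord w a = real_of_int (x $ idx a)" for a by (simp add: w coord_def)
  ultimately show "\<exists>x. lattice_fun x \<and> (\<forall>a\<in>carrier G. coord w a = real_of_int (x a))"
    by blast
next
  assume "\<exists>x. lattice_fun x \<and> (\<forall>a\<in>carrier G. coord w a = real_of_int (x a))"
  then obtain x where x: "lattice_fun x" "\<And>a. a \<in> carrier G \<Longrightarrow> coord w a = real_of_int (x a)"
    by blast
  have "w = (\<chi> i. real_of_int ((\<chi> i. x (g i)) $ i))"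
    by (rule vec_eqI) (simp add: x coord_def[of "vec_lambda _"])
  moreover have "(\<Sum>i\<in>UNIV. (\<chi> i. x (g i)) $ i) = 0"
    using x(1) by (simp add: lattice_fun_def sum_index)
  moreover have "(\<Otimes>j\<in>UNIV - {i\<^sub>0}. g j [^] ((\<chi> i. x (g i)) $ j)) = \<one>"
    using x(1) by (simp add: lattice_fun_def weight_index)
  ultimately show "w \<in> L" unfolding group_lattice_def by blast
qed

lemma lattice_fvec: "lattice_fun x \<Longrightarrow> fvec (\<lambda>a. real_of_int (x a)) \<in> L"
  unfolding lattice_iff by (intro exI[of _ x]) auto

lemma lattice_component_int: "w \<in> L \<Longrightarrow> w $ i \<in> \<int>"
  using lattice_iff[of w] by (metis Ints_of_int coord_def g_closed idx_g)

lemma lattice_minus: "w \<in> L \<Longrightarrow> - w \<in> L"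
  unfolding lattice_iff
proof (elim exE conjE)
  fix x assume "lattice_fun x" "\<forall>a\<in>carrier G. coord w a = real_of_int (x a)"
  then show "\<exists>x. lattice_fun x \<and> (\<forall>a\<in>carrier G. coord (- w) a = real_of_int (x a))"
    by (intro exI[of _ "\<lambda>a. - x a"]) (simp add: lattice_fun_def weight_minus sum_negf)
qed

text \<open>The vectors \<open>N (e_c - e_1)\<close> lie in \<open>L\<close> and suffice: if the
  coordinates of \<open>w\<close> sum to 0, then \<open>w\<close> is the combination of them with
  coefficients \<open>coord w c / N\<close>.\<close>

lemma span_lattice: "span L = {w. (\<Sum>a\<in>carrier G. coord w a) = 0}"
proof
  have "subspace {w. (\<Sum>a\<in>carrier G. coord w a) = 0}"
    by (rule subspaceI) (simp_all add: sum.distrib flip: sum_distrib_left)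
  moreover have "L \<subseteq> {w. (\<Sum>a\<in>carrier G. coord w a) = 0}"
  proof
    fix w assume "w \<in> L"
    then obtain x where x: "lattice_fun x" "\<forall>a\<in>carrier G. coord w a = real_of_int (x a)"
      unfolding lattice_iff by blast
    then have "(\<Sum>a\<in>carrier G. coord w a) = real_of_int (\<Sum>a\<in>carrier G. x a)" by simp
    with x show "w \<in> {w. (\<Sum>a\<in>carrier G. coord w a) = 0}" by (simp add: lattice_fun_def)
  qed
  ultimately show "span L \<subseteq> {w. (\<Sum>a\<in>carrier G. coord w a) = 0}" by (rule span_minimal[rotated])
next
  show "{w. (\<Sum>a\<in>carrier G. coord w a) = 0} \<subseteq> span L"
  proof
    fix w assume w: "w \<in> {w. (\<Sum>a\<in>carrier G. coord w a) = 0}"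
    define v where "v c = fvec (\<lambda>a. real_of_int (int N * (single c a - single \<one> a)))" for c
    have v: "v c \<in> L" if "c \<in> carrier G" for c
      unfolding v_def using that by (intro lattice_fvec lattice_fun_diff_single fin) auto
    have "w = (\<Sum>c\<in>carrier G. (coord w c / real N) *\<^sub>R v c)"
    proof (rule vec_eqI)
      fix a assume a: "a \<in> carrier G"
      have "coord (\<Sum>c\<in>carrier G. (coord w c / real N) *\<^sub>R v c) a
          = (\<Sum>c\<in>carrier G. coord w c * (real_of_int (single c a) - real_of_int (single \<one> a)))"
        using a N_pos by (simp add: coord_def[of "sum _ _"] v_def fvec_def)
      also have "\<dots> = (\<Sum>c\<in>carrier G. coord w c * real_of_int (single c a))
          - (\<Sum>c\<in>carrier G. coord w c) * real_of_int (single \<one> a)"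
        by (simp add: right_diff_distrib sum_subtractf sum_distrib_right)
      also have "\<dots> = (\<Sum>c\<in>carrier G. if a = c then coord w c else 0)"
        using w by (simp add: single_def) (intro sum.cong, auto)
      also have "\<dots> = coord w a" using a fin by simp
      finally show "coord w a = coord (\<Sum>c\<in>carrier G. (coord w c / real N) *\<^sub>R v c) a" by simp
    qed
    then show "w \<in> span L" using v by (metis (no_types, lifting) span_base span_scale span_sum)
  qed
qed

text \<open>The coordinate at \<open>a\<close> is moved to \<open>\<tau> a\<close>, hence the
  inverse inside. This makes \<open>permute\<close> covariant under composition, as
  \<open>act_mult\<close> requires.\<close>

definition permute :: "('a \<Rightarrow> 'a) \<Rightarrow> real ^ 'n \<Rightarrow> real ^ 'n" where
  "permute \<tau> w = fvec (\<lambda>a. coord w (inv_into (carrier G) \<tau> a))"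

context
  fixes \<tau> assumes \<tau>: "bij_betw \<tau> (carrier G) (carrier G)"
begin

lemma coord_permute: "a \<in> carrier G \<Longrightarrow> coord (permute \<tau> w) (\<tau> a) = coord w a"
  using \<tau> by (simp add: permute_def bij_betw_apply bij_betw_inv_into_left)

lemma permute_unique:
  assumes "\<And>a. a \<in> carrier G \<Longrightarrow> coord u (\<tau> a) = coord w a"
  shows "u = permute \<tau> w"
proof (rule vec_eqI)
  fix b assume "b \<in> carrier G"
  then obtain a where "a \<in> carrier G" "b = \<tau> a" using \<tau> by (auto simp: bij_betw_def)
  then show "coord u b = coord (permute \<tau> w) b" using assms coord_permute by simp
qed

lemma linear_permute: "linear (permute \<tau>)"
  by (rule linearI; rule vec_eqI) (simp_all add: permute_def)

lemma sum_permute: "(\<Sum>a\<in>carrier G. F (\<tau> a)) = (\<Sum>a\<in>carrier G. F a)"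
  using \<tau> by (rule sum.reindex_bij_betw)

lemma inner_permute: "permute \<tau> u \<bullet> permute \<tau> w = u \<bullet> w"
  unfolding inner_coord
  using sum_permute[of "\<lambda>a. coord (permute \<tau> u) a * coord (permute \<tau> w) a"]
  by (simp add: coord_permute)

end

text \<open>The pair \<open>(t, h)\<close> of the holomorph as a permutation of the group: composing
  these maps is the multiplication of \<open>holomorph G\<close>.\<close>

definition affine_map :: "'a \<Rightarrow> ('a \<Rightarrow> 'a) \<Rightarrow> 'a \<Rightarrow> 'a" where
  "affine_map t h = (\<lambda>a\<in>carrier G. t \<otimes> h a)"

lemma auto_closed: "h \<in> auto G \<Longrightarrow> a \<in> carrier G \<Longrightarrow> h a \<in> carrier G"
  by (auto simp: auto_def hom_def)

lemma auto_mult: "h \<in> auto G \<Longrightarrow> a \<in> carrier G \<Longrightarrow> b \<in> carrier G \<Longrightarrow> h (a \<otimes> b) = h a \<otimes> h b"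
  by (auto simp: auto_def hom_def)

lemma auto_one: "h \<in> auto G \<Longrightarrow> h \<one> = \<one>"
  by (auto simp: auto_def intro: hom_one)

lemma auto_compose: "h \<in> auto G \<Longrightarrow> k \<in> auto G \<Longrightarrow> compose (carrier G) h k \<in> auto G"
  by (auto simp: auto_def compose_Bij Bij_imp_funcset intro: hom_compose)

lemma bij_translate: "t \<in> carrier G \<Longrightarrow> bij_betw (\<lambda>a. t \<otimes> a) (carrier G) (carrier G)"
  by (rule bij_betw_byWitness[of _ "\<lambda>a. inv t \<otimes> a"]) (auto simp: m_assoc[symmetric])

lemma bij_affine_map:
  assumes "t \<in> carrier G" "h \<in> auto G"
  shows "bij_betw (affine_map t h) (carrier G) (carrier G)"
proof -
  have "bij_betw h (carrier G) (carrier G)" using assms by (simp add: auto_def Bij_def)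
  then have "bij_betw ((\<lambda>a. t \<otimes> a) \<circ> h) (carrier G) (carrier G)"
    using bij_translate[OF assms(1)] by (rule bij_betw_trans)
  then show ?thesis by (rule bij_betw_cong[THEN iffD1, rotated]) (simp add: affine_map_def)
qed

text \<open>Moving the coordinates by \<open>a \<mapsto> t h(a)\<close> turns the weight into
  \<open>t\<close> to the power of the coordinate sum, times \<open>h (weight x)\<close>. The first
  factor is trivial by the one defining condition of \<open>L\<close>, the second by the
  other.\<close>

lemma permute_affine_map_lattice:
  assumes t: "t \<in> carrier G" and h: "h \<in> auto G" and w: "w \<in> L"
  shows "permute (affine_map t h) w \<in> L"
proof -
  define \<tau> where "\<tau> = affine_map t h"
  have \<tau>: "bij_betw \<tau> (carrier G) (carrier G)" unfolding \<tau>_def using t h by (rule bij_affine_map)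
  obtain x where x: "lattice_fun x" "\<And>a. a \<in> carrier G \<Longrightarrow> coord w a = real_of_int (x a)"
    using w unfolding lattice_iff by blast
  define y where "y a = x (inv_into (carrier G) \<tau> a)" for a
  have y: "y (\<tau> a) = x a" if "a \<in> carrier G" for a
    using that \<tau> by (simp add: y_def bij_betw_inv_into_left)
  have "(\<Sum>a\<in>carrier G. y a) = 0"
    using sum_permute[OF \<tau>, of y] x(1) by (simp add: y lattice_fun_def)
  moreover have "weight y = \<one>"
  proof -
    have "weight y = (\<Otimes>a\<in>carrier G. \<tau> a [^] y (\<tau> a))"
      unfolding weight_def using \<tau> by (rule finprod_reindex_bij) auto
    also have "\<dots> = (\<Otimes>a\<in>carrier G. t [^] x a \<otimes> h (a [^] x a))"
    proof (intro finprod_cong' refl)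
      fix a assume a: "a \<in> carrier G"
      have "h (a [^] x a) = h a [^] x a"
        using h a by (intro hom_int_pow) (auto simp: auto_def)
      then show "\<tau> a [^] y (\<tau> a) = t [^] x a \<otimes> h (a [^] x a)"
        using a t h by (simp add: y) (simp add: \<tau>_def affine_map_def int_pow_distrib auto_closed)
    qed (use t h in \<open>auto simp: auto_closed\<close>)
    also have "\<dots> = (\<Otimes>a\<in>carrier G. t [^] x a) \<otimes> (\<Otimes>a\<in>carrier G. h (a [^] x a))"
      using t h by (intro finprod_multf) (auto simp: auto_closed)
    also have "(\<Otimes>a\<in>carrier G. h (a [^] x a)) = h (weight x)"
      unfolding weight_def using h by (intro hom_finprod[symmetric]) (auto simp: auto_def)
    also have "(\<Otimes>a\<in>carrier G. t [^] x a) \<otimes> h (weight x) = \<one>"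
      using x(1) t h by (simp add: lattice_fun_def finprod_int_pow_sum auto_one)
    finally show ?thesis .
  qed
  moreover have "coord (permute \<tau> w) a = real_of_int (y a)" if a: "a \<in> carrier G" for a
    using a \<tau> x(2) by (simp add: permute_def y_def bij_betw_def inv_into_into)
  ultimately show ?thesis unfolding lattice_iff lattice_fun_def \<tau>_def by blast
qed

section \<open>The embedding of \<open>C2Hol\<close> into the automorphisms of
  \<open>L\<close>\<close>

definition sgn2 :: "int \<Rightarrow> real" where "sgn2 e = (if e = 0 then 1 else -1)"

definition act :: "int \<times> 'a \<times> ('a \<Rightarrow> 'a) \<Rightarrow> real ^ 'n \<Rightarrow> real ^ 'n" where
  "act = (\<lambda>(e, t, h). \<lambda>w\<in>span L. sgn2 e *\<^sub>R permute (affine_map t h) w)"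

lemma carrier_C2Hol: "carrier C2Hol = {0, 1} \<times> carrier G \<times> auto G"
  by (auto simp: DirProd_def holomorph_def semidirect_prod_def AutoGroup_def carrier_integer_mod_group)

lemma mult_C2Hol:
  assumes "h \<in> auto G" "k \<in> auto G"
  shows "(e, t, h) \<otimes>\<^bsub>C2Hol\<^esub> (e', s, k) = ((e + e') mod 2, t \<otimes> h s, compose (carrier G) h k)"
  using assms
  by (simp add: DirProd_def holomorph_def semidirect_prod_def AutoGroup_def BijGroup_def auto_def)

lemma act_lattice_auto:
  assumes "p \<in> carrier C2Hol"
  shows "act p \<in> lattice_auto L"
proof -
  obtain e t h where p: "p = (e, t, h)" and t: "t \<in> carrier G" and h: "h \<in> auto G"
    using assms unfolding carrier_C2Hol by blast
  note \<tau> = bij_affine_map[OF t h]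
  have sg: "sgn2 e = 1 \<or> sgn2 e = -1" by (simp add: sgn2_def)
  have "restrict (\<lambda>w. sgn2 e *\<^sub>R permute (affine_map t h) w) (span L) \<in> lattice_auto L"
  proof (rule isometry_lattice_auto)
    show "linear (\<lambda>w. sgn2 e *\<^sub>R permute (affine_map t h) w)"
      using linear_permute[OF \<tau>] by (rule linear_compose_scale_right)
    show "norm (sgn2 e *\<^sub>R permute (affine_map t h) w) = norm w" for w
      using sg inner_permute[OF \<tau>, of w w] by (auto simp: norm_eq)
    show "(\<lambda>w. sgn2 e *\<^sub>R permute (affine_map t h) w) ` L \<subseteq> L"
      using sg permute_affine_map_lattice[OF t h] lattice_minus by auto
  qed (rule lattice_component_int)
  then show ?thesis by (simp add: act_def p)
qed

lemma act_mult:
  assumes "p \<in> carrier C2Hol" "q \<in> carrier C2Hol"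
  shows "act (p \<otimes>\<^bsub>C2Hol\<^esub> q) = act p \<otimes>\<^bsub>LatticeAutoGroup L\<^esub> act q"
proof -
  obtain e t h where p: "p = (e, t, h)" and e: "e \<in> {0, 1}" and t: "t \<in> carrier G" and h: "h \<in> auto G"
    using assms unfolding carrier_C2Hol by blast
  obtain e' s k where q: "q = (e', s, k)" and e': "e' \<in> {0, 1}" and s: "s \<in> carrier G" and k: "k \<in> auto G"
    using assms unfolding carrier_C2Hol by blast
  have hk: "compose (carrier G) h k \<in> auto G" using h k by (rule auto_compose)
  have ths: "t \<otimes> h s \<in> carrier G" using t h s by (simp add: auto_closed)
  have aff: "affine_map (t \<otimes> h s) (compose (carrier G) h k) a = affine_map t h (affine_map s k a)"
    if "a \<in> carrier G" for a
    using that t s h k by (simp add: affine_map_def compose_def auto_closed auto_mult m_assoc)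
  have perm: "permute (affine_map (t \<otimes> h s) (compose (carrier G) h k)) w
      = permute (affine_map t h) (permute (affine_map s k) w)" for w
  proof (rule permute_unique[OF bij_affine_map[OF ths hk], symmetric])
    fix a assume a: "a \<in> carrier G"
    have "affine_map s k a \<in> carrier G" using bij_affine_map[OF s k] a by (rule bij_betw_apply)
    then show "coord (permute (affine_map t h) (permute (affine_map s k) w))
        (affine_map (t \<otimes> h s) (compose (carrier G) h k) a) = coord w a"
      using a by (simp add: aff coord_permute[OF bij_affine_map[OF t h]] coord_permute[OF bij_affine_map[OF s k]])
  qed
  have sg: "sgn2 ((e + e') mod 2) = sgn2 e * sgn2 e'" using e e' by (auto simp: sgn2_def)
  have B: "act p \<in> Bij (span L)" "act q \<in> Bij (span L)"
    using act_lattice_auto assms by (auto simp: lattice_auto_def orthogonal_maps_on_def)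
  have "act p \<otimes>\<^bsub>LatticeAutoGroup L\<^esub> act q = compose (span L) (act p) (act q)"
    using B by (simp add: LatticeAutoGroup_def BijGroup_def)
  also have "\<dots> = act (p \<otimes>\<^bsub>C2Hol\<^esub> q)"
  proof (rule extensionalityI[of _ "span L"])
    fix w assume w: "w \<in> span L"
    then have "act q w \<in> span L" using B(2) by (auto simp: Bij_def bij_betw_def)
    then show "compose (span L) (act p) (act q) w = act (p \<otimes>\<^bsub>C2Hol\<^esub> q) w"
      using w unfolding p q mult_C2Hol[OF h k]
      by (simp add: compose_eq act_def perm sg linear_scale[OF linear_permute[OF bij_affine_map[OF t h]]])
  qed (simp_all only: act_def p q mult_C2Hol[OF h k] prod.case restrict_extensional compose_extensional)
  finally show ?thesis by simp
qed

lemma act_inj: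
  assumes "N \<ge> 3"
  shows "inj_on act (carrier C2Hol)"
proof (rule inj_onI)
  fix p q assume pq: "p \<in> carrier C2Hol" "q \<in> carrier C2Hol" "act p = act q"
  obtain e t h where p: "p = (e, t, h)" and e: "e \<in> {0, 1}" and t: "t \<in> carrier G" and h: "h \<in> auto G"
    using pq unfolding carrier_C2Hol by blast
  obtain e' s k where q: "q = (e', s, k)" and e': "e' \<in> {0, 1}" and s: "s \<in> carrier G" and k: "k \<in> auto G"
    using pq unfolding carrier_C2Hol by blast
  note \<tau> = bij_affine_map[OF t h] and \<sigma> = bij_affine_map[OF s k]
  have eq: "sgn2 e * coord (permute (affine_map t h) w) b = sgn2 e' * coord (permute (affine_map s k) w) b"
    if "w \<in> span L" for w b
    using fun_cong[OF pq(3), of w] that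
    by (simp add: act_def p q flip: coord_scaleR)
  have key: "affine_map t h a = affine_map s k a \<and> sgn2 e = sgn2 e'" if a: "a \<in> carrier G" for a
  proof -
    have "affine_map t h a \<in> carrier G" using \<tau> a by (rule bij_betw_apply)
    then obtain b where b: "b \<in> carrier G" "affine_map s k b = affine_map t h a"
      using \<sigma> by (metis bij_betw_def imageE)
    \<comment> \<open>A third element \<open>c\<close> lets e_a - e_c separate \<open>a\<close> from
      \<open>b\<close>: its coordinate at \<open>b\<close> is 0 unless \<open>b = a\<close>. With
      two elements only, the sign -1 would act like the exchange of the coordinates.\<close>
    have "card {a, b} \<le> 2" by (simp add: card_insert_if)
    then have "\<not> carrier G \<subseteq> {a, b}"
      using assms card_mono[of "{a, b}" "carrier G"] by (auto simp: order_def)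
    then obtain c where c: "c \<in> carrier G" "c \<noteq> a" "c \<noteq> b" by blast
    define w where "w = fvec (\<lambda>d. real_of_int (int N * (single a d - single c d)))"
    have "w \<in> span L" unfolding w_def
      using a c by (intro span_base lattice_fvec lattice_fun_diff_single fin)
    from eq[OF this, of "affine_map t h a"] have "sgn2 e * coord w a = sgn2 e' * coord w b"
      using coord_permute[OF \<tau> a, of w] coord_permute[OF \<sigma> b(1), of w] b(2) by simp
    then show ?thesis
      using a b c N_pos by (auto simp: w_def single_def sgn2_def split: if_splits)
  qed
  have "e = e'" using key[OF one_closed] e e' by (auto simp: sgn2_def split: if_splits)
  moreover have "t = s" using key[OF one_closed] t s h k by (simp add: affine_map_def auto_one)
  moreover have "h = k"
  proof (rule extensionalityI[of _ "carrier G"])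
    fix a assume a: "a \<in> carrier G"
    then show "h a = k a" using key[OF a] \<open>t = s\<close> t h k by (simp add: affine_map_def auto_closed)
  qed (use h k in \<open>auto simp: auto_def Bij_def\<close>)
  ultimately show "p = q" by (simp add: p q)
qed

lemma C2Hol_mult_closed:
  assumes "p \<in> carrier C2Hol" "q \<in> carrier C2Hol"
  shows "p \<otimes>\<^bsub>C2Hol\<^esub> q \<in> carrier C2Hol"
proof -
  obtain e t h where p: "p = (e, t, h)" and t: "t \<in> carrier G" and h: "h \<in> auto G"
    using assms unfolding carrier_C2Hol by blast
  obtain e' s k where q: "q = (e', s, k)" and s: "s \<in> carrier G" and k: "k \<in> auto G"
    using assms unfolding carrier_C2Hol by blast
  have "(e + e') mod 2 \<in> {0, 1}" by auto
  then show ?thesis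
    unfolding carrier_C2Hol p q mult_C2Hol[OF h k] using t s h k by (simp add: auto_closed auto_compose)
qed

lemma carrier_LatticeAutoGroup: "carrier (LatticeAutoGroup L) = lattice_auto L"
  by (simp add: LatticeAutoGroup_def)

lemma iso_if_act_surj:
  assumes "N \<ge> 3" and surj: "lattice_auto L \<subseteq> act ` carrier C2Hol"
  shows "LatticeAutoGroup L \<cong> C2Hol"
proof -
  let ?f = "inv_into (carrier C2Hol) act"
  have im: "act ` carrier C2Hol = lattice_auto L" using surj act_lattice_auto by blast
  have b: "bij_betw ?f (lattice_auto L) (carrier C2Hol)"
    using act_inj[OF assms(1)] im by (intro bij_betw_inv_into) (simp add: bij_betw_def)
  have "?f \<in> hom (LatticeAutoGroup L) C2Hol"
  proof (rule homI)
    fix x assume "x \<in> carrier (LatticeAutoGroup L)"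
    then show "?f x \<in> carrier C2Hol" using b by (simp add: carrier_LatticeAutoGroup bij_betw_apply)
  next
    fix x y assume "x \<in> carrier (LatticeAutoGroup L)" "y \<in> carrier (LatticeAutoGroup L)"
    then obtain p q where pq: "p \<in> carrier C2Hol" "q \<in> carrier C2Hol" "x = act p" "y = act q"
      unfolding carrier_LatticeAutoGroup im[symmetric] by blast
    then show "?f (x \<otimes>\<^bsub>LatticeAutoGroup L\<^esub> y) = ?f x \<otimes>\<^bsub>C2Hol\<^esub> ?f y"
      using act_inj[OF assms(1)] C2Hol_mult_closed[of p q] by (simp flip: act_mult)
  qed
  then show ?thesis using b by (auto simp: is_iso_def iso_def carrier_LatticeAutoGroup)
qed

text \<open>The given isomorphism may have nothing to do with \<open>act\<close>; only counting is
  used. \<open>C2Hol\<close> is finite, so \<open>lattice_auto L\<close> is finite of the same size,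
  and the injective \<open>act\<close> must be onto.\<close>

lemma act_surj_if_iso:
  assumes "N \<ge> 3" and "LatticeAutoGroup L \<cong> C2Hol"
  shows "act ` carrier C2Hol = lattice_auto L"
proof -
  have "auto G \<subseteq> carrier G \<rightarrow>\<^sub>E carrier G" by (auto simp: auto_def hom_def Bij_def PiE_def)
  then have "finite (auto G)" by (rule finite_subset) (intro finite_PiE fin)
  then have fC: "finite (carrier C2Hol)" unfolding carrier_C2Hol using fin by simp
  then have fA: "finite (lattice_auto L)"
    using iso_finite[OF assms(2)] by (simp add: carrier_LatticeAutoGroup)
  have "card (act ` carrier C2Hol) = card (lattice_auto L)"
    using iso_same_card[OF assms(2)] card_image[OF act_inj[OF assms(1)]]
    by (simp add: carrier_LatticeAutoGroup)
  then show ?thesis using fA act_lattice_auto by (intro card_subset_eq) auto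
qed

section \<open>The vectors p_c and the surjectivity of the action\<close>

definition pt :: "'a \<Rightarrow> real ^ 'n" where
  "pt c = fvec (\<lambda>a. (if a = c then 1 else 0) - 1 / real N)"

lemma coord_pt: "a \<in> carrier G \<Longrightarrow> coord (pt c) a = (if a = c then 1 else 0) - 1 / real N"
  by (simp add: pt_def)

lemma sum_coord_span: "w \<in> span L \<Longrightarrow> (\<Sum>a\<in>carrier G. coord w a) = 0"
  by (simp add: span_lattice)

text \<open>\<open>pt c\<close> is the projection p_c of e_c, and projecting does not change inner
  products with vectors of the span. In particular \<open>pt c\<close> pairs integrally with
  \<open>L\<close>.\<close>

lemma inner_pt:
  assumes "w \<in> span L" "c \<in> carrier G"
  shows "w \<bullet> pt c = coord w c"
proof -
  have "w \<bullet> pt c = (\<Sum>a\<in>carrier G. (if a = c then coord w a else 0) - coord w a * (1 / real N))"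
    unfolding inner_coord by (intro sum.cong) (auto simp: coord_pt right_diff_distrib)
  also have "\<dots> = coord w c - (\<Sum>a\<in>carrier G. coord w a) * (1 / real N)"
    using assms fin by (simp add: sum_subtractf sum_divide_distrib)
  finally show ?thesis using assms by (simp add: sum_coord_span)
qed

lemma pt_span: "c \<in> carrier G \<Longrightarrow> pt c \<in> span L"
  using fin N_pos by (auto simp: span_lattice coord_pt sum_subtractf order_def)

lemma minimal_dual_vector_pt:
  assumes n: "N \<in> {3, 4, 6} \<or> N \<ge> 12"
    and w: "w \<in> span L" "w \<bullet> w = 1 - 1 / real N" and dual: "\<And>x. x \<in> L \<Longrightarrow> w \<bullet> x \<in> \<int>"
  obtains c s where "c \<in> carrier G" "s = 1 \<or> s = -1" "w = s *\<^sub>R pt c"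
proof -
  have hom: "coord w (a \<otimes> b) + coord w \<one> - coord w a - coord w b \<in> \<int>"
    if ab: "a \<in> carrier G" "b \<in> carrier G" for a b
  proof -
    define x where "x = fvec (\<lambda>y. real_of_int (single (a \<otimes> b) y + single \<one> y + - single a y + - single b y))"
    have "x \<in> L" unfolding x_def
      using lattice_fun_relation[OF fin, of "a \<otimes> b" \<one> a b] ab by (intro lattice_fvec) simp
    moreover have "w \<bullet> x = coord w (a \<otimes> b) + coord w \<one> - coord w a - coord w b"
    proof -
      have "w \<bullet> x = (\<Sum>y\<in>carrier G. coord w y * real_of_int (single (a \<otimes> b) y)
          + coord w y * real_of_int (single \<one> y) - coord w y * real_of_int (single a y)
          - coord w y * real_of_int (single b y))"
        unfolding inner_coord by (intro sum.cong) (auto simp: x_def algebra_simps)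
      moreover have "(\<Sum>y\<in>carrier G. coord w y * real_of_int (single c y)) = coord w c"
        if "c \<in> carrier G" for c
      proof -
        have "(\<Sum>y\<in>carrier G. coord w y * real_of_int (single c y))
            = (\<Sum>y\<in>carrier G. if y = c then coord w y else 0)"
          by (intro sum.cong) (auto simp: single_def)
        then show ?thesis using that fin by simp
      qed
      ultimately show ?thesis using ab by (simp add: sum.distrib sum_subtractf)
    qed
    ultimately show ?thesis using dual[of x] by simp
  qed
  have norm: "(\<Sum>a\<in>carrier G. (coord w a)\<^sup>2) = 1 - 1 / real N"
    using w(2) unfolding inner_coord by (simp add: power2_eq_square)
  obtain c s where "c \<in> carrier G" "s = 1 \<or> s = -1"
    "\<And>a. a \<in> carrier G \<Longrightarrow> coord w a = s * ((if a = c then 1 else 0) - 1 / real N)"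
    using minimal_dual_vector[OF fin refl n hom sum_coord_span[OF w(1)] norm] by blast
  then show ?thesis using that[of c s] by (intro that[of c s]) (auto intro!: vec_eqI simp: coord_pt)
qed

lemma act_surj:
  assumes n: "N \<in> {3, 4, 6} \<or> N \<ge> 12"
  shows "lattice_auto L \<subseteq> act ` carrier C2Hol"
proof
  fix F assume F: "F \<in> lattice_auto L"
  have N3: "real N \<ge> 3" using n by auto
  have bijF: "bij_betw F (span L) (span L)" and extF: "F \<in> extensional (span L)"
    and FL: "F ` L = L" and Finner: "\<And>v w. v \<in> span L \<Longrightarrow> w \<in> span L \<Longrightarrow> F v \<bullet> F w = v \<bullet> w"
    using F by (auto simp: lattice_auto_def orthogonal_maps_on_def Bij_def)
  have Fspan: "F w \<in> span L" if "w \<in> span L" for w using bijF that by (rule bij_betw_apply)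
  have ptpt: "pt c \<bullet> pt d = (if c = d then 1 else 0) - 1 / real N"
    if "c \<in> carrier G" "d \<in> carrier G" for c d
    using inner_pt[OF pt_span[OF that(1)] that(2)] that by (simp add: coord_pt)
  have "\<exists>d s. d \<in> carrier G \<and> (s = 1 \<or> s = (-1::real)) \<and> F (pt c) = s *\<^sub>R pt d"
    if c: "c \<in> carrier G" for c
  proof -
    \<comment> \<open>Since \<open>F\<close> maps \<open>L\<close> onto \<open>L\<close>, it maps
      dual vectors to dual vectors: pull \<open>x\<close> back to \<open>x'\<close> and read off one
      of its coordinates.\<close>
    have "F (pt c) \<bullet> x \<in> \<int>" if "x \<in> L" for x
    proof -
      obtain x' where x': "x' \<in> L" "x = F x'" using FL \<open>x \<in> L\<close> by blast
      then have "F (pt c) \<bullet> x = x' \<bullet> pt c"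
        using Finner[of "pt c" x'] c by (simp add: pt_span span_base inner_commute)
      also have "\<dots> = x' $ idx c" using x' c by (simp add: inner_pt span_base coord_def)
      finally show ?thesis using x'(1) by (simp add: lattice_component_int)
    qed
    moreover have "F (pt c) \<bullet> F (pt c) = 1 - 1 / real N" using c by (simp add: Finner pt_span ptpt)
    ultimately show ?thesis
      using minimal_dual_vector_pt[OF n Fspan[OF pt_span[OF c]]] by metis
  qed
  then obtain \<tau> \<epsilon> where \<tau>: "\<And>c. c \<in> carrier G \<Longrightarrow> \<tau> c \<in> carrier G"
    and \<epsilon>: "\<And>c. c \<in> carrier G \<Longrightarrow> \<epsilon> c = 1 \<or> \<epsilon> c = (-1::real)"
    and Fpt: "\<And>c. c \<in> carrier G \<Longrightarrow> F (pt c) = \<epsilon> c *\<^sub>R pt (\<tau> c)"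
    by metis
  have pair: "\<tau> c \<noteq> \<tau> d \<and> \<epsilon> c = \<epsilon> d" if cd: "c \<in> carrier G" "d \<in> carrier G" "c \<noteq> d" for c d
  proof -
    have "F (pt c) \<bullet> F (pt d) = - 1 / real N" using cd by (simp add: Finner pt_span ptpt)
    moreover have "F (pt c) \<bullet> F (pt d) = \<epsilon> c * \<epsilon> d * (pt (\<tau> c) \<bullet> pt (\<tau> d))"
      using cd by (simp add: Fpt)
    moreover have "pt (\<tau> c) \<bullet> pt (\<tau> d) = (if \<tau> c = \<tau> d then 1 else 0) - 1 / real N"
      using cd by (intro ptpt \<tau>)
    ultimately have e: "\<epsilon> c * \<epsilon> d * ((if \<tau> c = \<tau> d then 1 else 0) - 1 / real N) = - 1 / real N"
      by (simp only:)
    have s: "\<epsilon> c * \<epsilon> d = 1 \<or> \<epsilon> c * \<epsilon> d = - 1" using \<epsilon>[OF cd(1)] \<epsilon>[OF cd(2)] by auto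
    have r: "0 < 1 / real N" "1 / real N \<le> 1 / 3" using N3 by (auto simp: field_simps)
    \<comment> \<open>Here \<open>r\<close> is \<open>1/n\<close>. The first inequality would fail
      at \<open>r = 1/2\<close>, which \<open>n \<ge> 3\<close> excludes; it makes
      \<open>\<tau>\<close> injective. The second part then makes the signs agree.\<close>
    have signs: "k * (1 - r) \<noteq> - r" "k * (- r) = - r \<Longrightarrow> k = 1"
      if "k = 1 \<or> k = - 1" "0 < r" "r \<le> 1 / 3" for k r :: real using that by auto
    have "\<tau> c \<noteq> \<tau> d"
    proof
      assume "\<tau> c = \<tau> d"
      with e have "\<epsilon> c * \<epsilon> d * (1 - 1 / real N) = - (1 / real N)" by simp
      with signs(1)[OF s r] show False by (rule notE)
    qed
    moreover from this e have "\<epsilon> c * \<epsilon> d * (- (1 / real N)) = - (1 / real N)" by simp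
    then have "\<epsilon> c * \<epsilon> d = 1" by (rule signs(2)[OF s r])
    ultimately show ?thesis using \<epsilon>[OF cd(1)] \<epsilon>[OF cd(2)] by auto
  qed
  define s where "s = \<epsilon> \<one>"
  have \<epsilon>s: "\<epsilon> c = s" if "c \<in> carrier G" for c using pair[OF that one_closed] by (cases "c = \<one>") (auto simp: s_def)
  have s: "s = 1 \<or> s = -1" using \<epsilon>[OF one_closed] by (simp add: s_def)
  have "inj_on \<tau> (carrier G)" using pair by (auto simp: inj_on_def)
  moreover from this have "\<tau> ` carrier G = carrier G" using \<tau> fin by (intro endo_inj_surj) auto
  ultimately have bij\<tau>: "bij_betw \<tau> (carrier G) (carrier G)" by (simp add: bij_betw_def)
  have coordF: "coord (F w) (\<tau> c) = s * coord w c" if w: "w \<in> span L" and c: "c \<in> carrier G" for w c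
  proof -
    have "s * coord (F w) (\<tau> c) = F w \<bullet> F (pt c)"
      using w c by (simp add: Fpt \<epsilon>s inner_pt Fspan \<tau>)
    also have "\<dots> = coord w c" using w c by (simp add: Finner pt_span inner_pt)
    finally show ?thesis using s by auto
  qed
  \<comment> \<open>Up to the sign, the relation vector of \<open>a\<close> and \<open>b\<close>
    goes to the vector with \<open>\<tau>\<close> applied to all four positions. As that lies in
    \<open>L\<close> too, its weight is trivial, which is the claimed identity. So
    \<open>\<tau>\<close> is a homomorphism up to the translation by
    \<open>\<tau> \<one>\<close>.\<close>
  have \<tau>mult: "\<tau> (a \<otimes> b) \<otimes> \<tau> \<one> = \<tau> a \<otimes> \<tau> b" if ab: "a \<in> carrier G" "b \<in> carrier G" for a b
  proof -
    define r where "r y = single (a \<otimes> b) y + single \<one> y + - single a y + - single b y" for y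
    define r' where "r' y = single (\<tau> (a \<otimes> b)) y + single (\<tau> \<one>) y + - single (\<tau> a) y + - single (\<tau> b) y" for y
    have v: "fvec (\<lambda>y. real_of_int (r y)) \<in> L" unfolding r_def
      using lattice_fun_relation[OF fin, of "a \<otimes> b" \<one> a b] ab by (intro lattice_fvec) simp
    define u where "u = s *\<^sub>R F (fvec (\<lambda>y. real_of_int (r y)))"
    have "F (fvec (\<lambda>y. real_of_int (r y))) \<in> L" using v FL by blast
    then have "u \<in> L" using s lattice_minus by (auto simp: u_def)
    then obtain y where y: "lattice_fun y" "\<And>c. c \<in> carrier G \<Longrightarrow> coord u c = real_of_int (y c)"
      unfolding lattice_iff by blast
    have single\<tau>: "single (\<tau> c) (\<tau> d) = single c d" if "c \<in> carrier G" "d \<in> carrier G" for c d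
      using that bij\<tau> by (auto simp: single_def bij_betw_def inj_on_def)
    have "y d = r' d" if d: "d \<in> carrier G" for d
    proof -
      obtain c where c: "c \<in> carrier G" "d = \<tau> c" using bij\<tau> d by (auto simp: bij_betw_def)
      have "real_of_int (y d) = coord u d" using y(2) d by simp
      also have "\<dots> = s * (s * real_of_int (r c))"
        using c coordF[OF span_base[OF v] c(1)] by (simp add: u_def)
      also have "\<dots> = real_of_int (r' d)"
        using s c ab by (auto simp: r_def r'_def single\<tau>)
      finally show ?thesis by simp
    qed
    then have "lattice_fun r'"
      using y(1) weight_cong[of y r'] by (simp add: lattice_fun_def)
    then show ?thesis unfolding r'_def using lattice_fun_relation[OF fin] ab \<tau> by simp
  qed
  define t where "t = \<tau> \<one>"
  have t: "t \<in> carrier G" by (simp add: t_def \<tau>)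
  define h where "h = (\<lambda>a\<in>carrier G. inv t \<otimes> \<tau> a)"
  have "bij_betw h (carrier G) (carrier G)"
  proof -
    have "bij_betw ((\<lambda>a. inv t \<otimes> a) \<circ> \<tau>) (carrier G) (carrier G)"
      using bij\<tau> bij_translate[of "inv t"] t by (intro bij_betw_trans) auto
    then show ?thesis by (rule bij_betw_cong[THEN iffD1, rotated]) (simp add: h_def)
  qed
  moreover have "h (a \<otimes> b) = h a \<otimes> h b" if ab: "a \<in> carrier G" "b \<in> carrier G" for a b
  proof -
    have "\<tau> (a \<otimes> b) = \<tau> a \<otimes> \<tau> b \<otimes> inv t"
      using \<tau>mult[OF ab] ab t \<tau> by (simp add: t_def inv_solve_right)
    then show ?thesis using ab t \<tau> by (simp add: h_def m_ac)
  qed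
  ultimately have h: "h \<in> auto G"
    by (auto simp: auto_def hom_def Bij_def bij_betw_apply) (simp add: h_def)
  have aff: "affine_map t h a = \<tau> a" if "a \<in> carrier G" for a
    using that t \<tau> by (simp add: affine_map_def h_def m_assoc[symmetric])
  have perm: "F w = s *\<^sub>R permute (affine_map t h) w" if w: "w \<in> span L" for w
  proof -
    have "s *\<^sub>R F w = permute (affine_map t h) w"
      using s coordF[OF w] by (intro permute_unique[OF bij_affine_map[OF t h]]) (auto simp: aff)
    then have "s *\<^sub>R (s *\<^sub>R F w) = s *\<^sub>R permute (affine_map t h) w" by (simp only:)
    then show ?thesis using s by auto
  qed
  define e :: int where "e = (if s = 1 then 0 else 1)"
  have "sgn2 e = s" using s by (auto simp: sgn2_def e_def)
  then have "F = act (e, t, h)"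
    using extF perm by (intro extensionalityI[of _ "span L"]) (auto simp: act_def)
  moreover have "(e, t, h) \<in> carrier C2Hol" unfolding carrier_C2Hol using t h by (simp add: e_def)
  ultimately show "F \<in> act ` carrier C2Hol" by blast
qed

text \<open>An element of \<open>C2Hol\<close> only permutes the coordinates and changes a global
  sign. So a coordinate of the image of \<open>x\<close> whose absolute value does not occur in
  \<open>x\<close> exhibits an automorphism outside the image of \<open>act\<close>, and by
  \<open>act_surj_if_iso\<close> there is no isomorphism at all. \<open>T\<close> acts on functions
  on the whole type, hence the hypothesis that it depends only on the values on the group.\<close>

lemma not_iso_if_extra:
  fixes T :: "('a \<Rightarrow> real) \<Rightarrow> 'a \<Rightarrow> real" and x :: "'a \<Rightarrow> int"
  assumes "N \<ge> 3"
    and cong: "\<And>F F' a. (\<And>b. b \<in> carrier G \<Longrightarrow> F b = F' b) \<Longrightarrow> a \<in> carrier G \<Longrightarrow> T F a = T F' a"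
    and add: "\<And>F F' a. a \<in> carrier G \<Longrightarrow> T (\<lambda>b. F b + F' b) a = T F a + T F' a"
    and scale: "\<And>r F a. a \<in> carrier G \<Longrightarrow> T (\<lambda>b. r * F b) a = r * T F a"
    and isometry: "\<And>F. (\<Sum>a\<in>carrier G. (T F a)\<^sup>2) = (\<Sum>a\<in>carrier G. (F a)\<^sup>2)"
    and lattice: "\<And>x. lattice_fun x \<Longrightarrow>
      \<exists>y. lattice_fun y \<and> (\<forall>a\<in>carrier G. T (\<lambda>b. real_of_int (x b)) a = real_of_int (y a))"
    and x: "lattice_fun x" and a: "a \<in> carrier G"
    and extra: "\<And>b. b \<in> carrier G \<Longrightarrow> \<bar>T (\<lambda>b. real_of_int (x b)) a\<bar> \<noteq> \<bar>real_of_int (x b)\<bar>"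
  shows "\<not> LatticeAutoGroup L \<cong> C2Hol"
proof
  assume iso: "LatticeAutoGroup L \<cong> C2Hol"
  define U where "U w = fvec (T (coord w))" for w
  have "restrict U (span L) \<in> lattice_auto L"
  proof (rule isometry_lattice_auto)
    show "linear U"
    proof (rule linearI; rule vec_eqI)
      fix u w a assume "a \<in> carrier G"
      moreover have "coord (u + w) = (\<lambda>b. coord u b + coord w b)" by (rule ext) simp
      ultimately show "coord (U (u + w)) a = coord (U u + U w) a" by (simp add: U_def add)
    next
      fix r w a assume "a \<in> carrier G"
      moreover have "coord (r *\<^sub>R w) = (\<lambda>b. r * coord w b)" by (rule ext) simp
      ultimately show "coord (U (r *\<^sub>R w)) a = coord (r *\<^sub>R U w) a" by (simp add: U_def scale)
    qed
    show "norm (U w) = norm w" for w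
      using isometry[of "coord w"] by (simp add: norm_eq inner_coord U_def flip: power2_eq_square)
    show "U ` L \<subseteq> L"
    proof
      fix u assume "u \<in> U ` L"
      then obtain w x where w: "u = U w" "lattice_fun x" "\<And>a. a \<in> carrier G \<Longrightarrow> coord w a = real_of_int (x a)"
        by (auto simp: lattice_iff)
      obtain y where "lattice_fun y" "\<forall>a\<in>carrier G. T (\<lambda>b. real_of_int (x b)) a = real_of_int (y a)"
        using lattice[OF w(2)] by blast
      then show "u \<in> L"
        unfolding lattice_iff using w cong[of "coord w" "\<lambda>b. real_of_int (x b)"]
        by (intro exI[of _ y]) (simp add: U_def)
    qed
  qed (rule lattice_component_int)
  then obtain p where p: "p \<in> carrier C2Hol" "restrict U (span L) = act p"
    using act_surj_if_iso[OF assms(1) iso] by blast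
  obtain e t h where e: "p = (e, t, h)" and t: "t \<in> carrier G" and h: "h \<in> auto G"
    using p unfolding carrier_C2Hol by blast
  note \<tau> = bij_affine_map[OF t h]
  define w where "w = fvec (\<lambda>b. real_of_int (x b))"
  have w: "w \<in> span L" unfolding w_def using x by (intro span_base lattice_fvec)
  obtain b where b: "b \<in> carrier G" "affine_map t h b = a" using \<tau> a by (metis bij_betw_def imageE)
  have "T (\<lambda>b. real_of_int (x b)) a = coord (U w) a"
    using a cong[of "coord w" "\<lambda>b. real_of_int (x b)"] by (simp add: U_def w_def)
  also have "\<dots> = coord (act p w) a" using p(2) w by (metis restrict_apply')
  also have "\<dots> = sgn2 e * coord w b"
    using w coord_permute[OF \<tau> b(1), of w] b(2) by (simp add: act_def e)
  also have "\<bar>\<dots>\<bar> = \<bar>real_of_int (x b)\<bar>" using b by (simp add: w_def sgn2_def abs_mult)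
  finally show False using extra[OF b(1)] by simp
qed

end

section \<open>Extra automorphisms\<close>

context comm_group
begin

context
  fixes S :: "'a set" and c :: 'a
  assumes S: "S \<subseteq> carrier G" and c: "c \<in> carrier G" and S_closed: "\<And>a. a \<in> S \<Longrightarrow> c \<otimes> inv a \<in> S"
begin

lemma bij_point_reflection: "bij_betw (\<lambda>a. c \<otimes> inv a) S S"
proof -
  have "c \<otimes> inv (c \<otimes> inv a) = a" if "a \<in> S" for a
  proof -
    have a: "a \<in> carrier G" using that S by blast
    have "c \<otimes> inv (c \<otimes> inv a) = c \<otimes> (inv c \<otimes> a)" using a c by (simp add: inv_mult)
    also have "\<dots> = a" using a c by (simp flip: m_assoc)
    finally show ?thesis .
  qed
  then show ?thesis using S_closed by (intro bij_betw_byWitness[of _ "\<lambda>a. c \<otimes> inv a"]) auto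
qed

lemma sum_point_reflection: "(\<Sum>a\<in>S. F (c \<otimes> inv a)) = (\<Sum>a\<in>S. F a)"
  using bij_point_reflection by (rule sum.reindex_bij_betw)

lemma finprod_point_reflection:
  "(\<Otimes>a\<in>S. a [^] (x (c \<otimes> inv a) :: int)) = c [^] (\<Sum>a\<in>S. x a) \<otimes> inv (\<Otimes>a\<in>S. a [^] x a)"
proof -
  have sub: "a \<in> carrier G" if "a \<in> S" for a using that S by blast
  have "(\<Otimes>a\<in>S. a [^] x (c \<otimes> inv a)) = (\<Otimes>a\<in>S. (c \<otimes> inv a) [^] x (c \<otimes> inv (c \<otimes> inv a)))"
    using bij_point_reflection by (rule finprod_reindex_bij) (use sub in auto)
  also have "\<dots> = (\<Otimes>a\<in>S. c [^] x a \<otimes> inv (a [^] x a))"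
  proof (intro finprod_cong' refl)
    fix a assume "a \<in> S"
    then have a: "a \<in> carrier G" by (rule sub)
    have "c \<otimes> inv (c \<otimes> inv a) = c \<otimes> (inv c \<otimes> a)" using a c by (simp add: inv_mult)
    also have "\<dots> = a" using a c by (simp flip: m_assoc)
    finally show "(c \<otimes> inv a) [^] x (c \<otimes> inv (c \<otimes> inv a)) = c [^] x a \<otimes> inv (a [^] x a)"
      using a c by (simp add: int_pow_distrib int_pow_inv)
  qed (use sub c in auto)
  also have "\<dots> = (\<Otimes>a\<in>S. c [^] x a) \<otimes> (\<Otimes>a\<in>S. inv (a [^] x a))"
    using sub c by (intro finprod_multf) auto
  also have "\<dots> = c [^] (\<Sum>a\<in>S. x a) \<otimes> inv (\<Otimes>a\<in>S. a [^] x a)"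
    using c sub by (subst finprod_inv) (auto simp: finprod_int_pow_sum)
  finally show ?thesis .
qed

end

text \<open>Modulo \<open>H\<close> all elements of the coset agree with \<open>t\<close>, so only
  the coordinate sum over the coset matters. This is what forces divisibility of coset sums on
  \<open>L\<close>.\<close>

lemma finprod_coset_int_pow:
  assumes H: "subgroup H G" and t: "t \<in> carrier G"
  obtains k where "k \<in> H" "(\<Otimes>a\<in>(\<lambda>k. t \<otimes> k) ` H. a [^] (x a :: int)) = t [^] (\<Sum>a\<in>(\<lambda>k. t \<otimes> k) ` H. x a) \<otimes> k"
proof -
  interpret H: subgroup H G by fact
  let ?S = "(\<lambda>k. t \<otimes> k) ` H"
  have sub: "a \<in> carrier G" "inv t \<otimes> a \<in> H" if "a \<in> ?S" for a
    using that t H.subset by (auto simp flip: m_assoc)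
  have "(\<Otimes>a\<in>?S. a [^] x a) = (\<Otimes>a\<in>?S. t [^] x a \<otimes> (inv t \<otimes> a) [^] x a)"
  proof (intro finprod_cong' refl)
    fix a assume "a \<in> ?S"
    then have a: "a \<in> carrier G" by (rule sub)
    have "t [^] x a \<otimes> (inv t \<otimes> a) [^] x a = (t \<otimes> (inv t \<otimes> a)) [^] x a"
      using a t by (simp add: int_pow_distrib)
    then show "a [^] x a = t [^] x a \<otimes> (inv t \<otimes> a) [^] x a" using a t by (simp flip: m_assoc)
  qed (use sub t in auto)
  also have "\<dots> = (\<Otimes>a\<in>?S. t [^] x a) \<otimes> (\<Otimes>a\<in>?S. (inv t \<otimes> a) [^] x a)"
    using sub t by (intro finprod_multf) auto
  also have "(\<Otimes>a\<in>?S. t [^] x a) = t [^] (\<Sum>a\<in>?S. x a)" using t by (rule finprod_int_pow_sum)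
  finally have "(\<Otimes>a\<in>?S. a [^] x a) = t [^] (\<Sum>a\<in>?S. x a) \<otimes> (\<Otimes>a\<in>?S. (inv t \<otimes> a) [^] x a)" .
  moreover have "(\<Otimes>a\<in>?S. (inv t \<otimes> a) [^] x a) \<in> H"
    using sub by (intro finprod_closed_subgroup H comm_group_axioms) (auto intro: subgroup_int_pow_closed[OF H])
  ultimately show ?thesis using that by blast
qed

lemma finprod_coset:
  assumes "subgroup H G" "t \<in> carrier G"
  shows "(\<Otimes>a\<in>(\<lambda>k. t \<otimes> k) ` H. a) = t [^] card H \<otimes> (\<Otimes>a\<in>H. a)"
proof -
  interpret H: subgroup H G by fact
  have sub: "a \<in> carrier G" if "a \<in> H" for a using that H.subset by blast
  have "(\<Otimes>a\<in>(\<lambda>k. t \<otimes> k) ` H. a) = (\<Otimes>k\<in>H. t \<otimes> k)"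
    using assms sub by (intro finprod_reindex) (auto simp: inj_on_def)
  also have "\<dots> = (\<Otimes>k\<in>H. t) \<otimes> (\<Otimes>k\<in>H. k)" using assms sub by (intro finprod_multf) auto
  finally show ?thesis using assms by (simp add: finprod_const)
qed

lemma int_pow_mod_mem_subgroup:
  assumes H: "subgroup H G" and t: "t \<in> carrier G" and "t [^] (m::int) \<in> H" "t [^] (z::int) \<in> H"
  shows "t [^] (z mod m) \<in> H"
proof -
  interpret H: subgroup H G by fact
  have "t [^] (z mod m) = t [^] (z - m * (z div m))" by (simp add: minus_mult_div_eq_mod)
  also have "\<dots> = t [^] z \<otimes> inv ((t [^] m) [^] (z div m))" using t by (simp add: int_pow_diff int_pow_pow)
  also have "\<dots> \<in> H" using assms by (auto intro: subgroup_int_pow_closed[OF H])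
  finally show ?thesis .
qed

lemma subgroup_pow_card:
  assumes "subgroup H G" "finite H" "a \<in> H"
  shows "a [^] card H = \<one>"
proof -
  interpret H: subgroup H G by fact
  interpret HG: group "G\<lparr>carrier := H\<rparr>" using assms(1) by (rule subgroup_imp_group)
  show ?thesis using HG.pow_order_eq_1[of a] assms nat_pow_consistent[of a "card H" H] by (simp add: order_def)
qed

text \<open>Pick an involution \<open>a\<close>, and \<open>b\<close> outside
  \<open>{\<one>, a}\<close>: then \<open>H\<close> consists of \<open>\<one>\<close>,
  \<open>a\<close>, \<open>b\<close> and \<open>a b\<close>, whose product is
  \<open>(a a)(b b) = b b\<close>. The square root \<open>d\<close> is needed to centre the point
  reflection for order 8.\<close>

lemma finprod_subgroup_of_card_4:
  assumes H: "subgroup H G" and card: "card H = 4"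
  obtains d where "d \<in> H" "d \<otimes> d = (\<Otimes>a\<in>H. a)"
proof -
  interpret H: subgroup H G by fact
  have finH: "finite H" using card by (intro card_ge_0_finite) simp
  have sub: "a \<in> carrier G" if "a \<in> H" for a using that H.subset by blast
  have "\<not> H \<subseteq> {\<one>}" using card card_mono[of "{\<one>}" H] by auto
  then obtain a0 where a0: "a0 \<in> H" "a0 \<noteq> \<one>" by blast
  obtain a where a: "a \<in> H" "a \<noteq> \<one>" "a \<otimes> a = \<one>"
  proof (cases "a0 \<otimes> a0 = \<one>")
    case True
    then show ?thesis using a0 that by blast
  next
    case False
    have "a0 [^] (4::nat) = \<one>" using subgroup_pow_card[OF H finH a0(1)] card by simp
    then have "(a0 \<otimes> a0) \<otimes> (a0 \<otimes> a0) = \<one>" using a0 sub by (simp add: eval_nat_numeral m_assoc)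
    then show ?thesis using a0 False that[of "a0 \<otimes> a0"] by simp
  qed
  have "card {\<one>, a} \<le> 2" by (simp add: card_insert_if)
  then have "\<not> H \<subseteq> {\<one>, a}" using card card_mono[of "{\<one>, a}" H] by auto
  then obtain b where b: "b \<in> H" "b \<noteq> \<one>" "b \<noteq> a" by blast
  have cG: "a \<in> carrier G" "b \<in> carrier G" using a b sub by auto
  have "a \<otimes> b \<noteq> a \<otimes> a" using b cG by simp
  then have "a \<otimes> b \<noteq> \<one>" using a(3) by simp
  moreover have "a \<otimes> b \<noteq> a" "a \<otimes> b \<noteq> b" using a b cG by auto
  ultimately have "card {\<one>, a, b, a \<otimes> b} = 4" using a b by auto
  then have Heq: "H = {\<one>, a, b, a \<otimes> b}"
    using a b finH card by (intro card_subset_eq[symmetric]) auto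
  have "(\<Otimes>k\<in>{\<one>, a, b, a \<otimes> b}. k) = \<one> \<otimes> (a \<otimes> (b \<otimes> (a \<otimes> b)))"
    using a b cG \<open>a \<otimes> b \<noteq> \<one>\<close> \<open>a \<otimes> b \<noteq> a\<close> \<open>a \<otimes> b \<noteq> b\<close> by (simp add: Pi_iff)
  also have "\<dots> = (a \<otimes> a) \<otimes> (b \<otimes> b)" using cG by (simp add: m_ac)
  also have "\<dots> = b \<otimes> b" using a cG by simp
  finally show ?thesis using Heq b that by metis
qed

end

section \<open>Groups of order 8\<close>

context indexed_abelian_group
begin

text \<open>
  The extra automorphism fixes the coordinates in a subgroup \<open>H\<close> of index 2 and acts on those in
  the coset \<open>C\<close> by \<open>x \<mapsto> s/2 - x\<close> followed by a point reflection of \<open>C\<close>, where \<open>s\<close>, the sum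
  over \<open>C\<close>, is even on \<open>L\<close>.
\<close>

lemma not_iso_8:
  assumes N: "N = 8"
  shows "\<not> LatticeAutoGroup L \<cong> C2Hol"
proof -
  have cardG: "card (carrier G) = 8" using N by (simp add: order_def)
  obtain H where H: "subgroup H G" and card: "card H = 4"
    using sylow_thm[of 2 G 2 2] fin N is_group by auto
  interpret H: subgroup H G by fact
  have sub: "a \<in> carrier G" if "a \<in> H" for a using that H.subset by blast
  have finH: "finite H" using fin H.subset by (rule rev_finite_subset)
  have "H \<noteq> carrier G" using card cardG by auto
  then obtain t where t: "t \<in> carrier G" "t \<notin> H" using H.subset by blast
  define C where "C = (\<lambda>k. t \<otimes> k) ` H"
  have finC: "finite C" using finH by (simp add: C_def)
  have Csub: "C \<subseteq> carrier G" using t H.subset by (auto simp: C_def)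
  have mulH: "k \<in> H" if "a \<in> carrier G" "k' \<in> H" "a \<otimes> k' = k''" "k'' \<in> H" "k = a" for a k k' k''
  proof -
    have "a = k'' \<otimes> inv k'" using that sub by (metis inv_solve_right)
    then show ?thesis using that by auto
  qed
  have disj: "H \<inter> C = {}" using mulH[of t] t by (fastforce simp: C_def)
  have cardC: "card C = 4" unfolding C_def using t sub card by (subst card_image) (auto simp: inj_on_def)
  have un: "carrier G = H \<union> C"
    using Csub H.subset disj card cardC cardG fin finH finC
    by (intro card_subset_eq[symmetric]) (auto simp: card_Un_disjoint)
  have t2: "t \<otimes> t \<in> H"
  proof (rule ccontr)
    assume "t \<otimes> t \<notin> H"
    then have "t \<otimes> t \<in> C" using un t by auto
    then obtain k where "k \<in> H" "t \<otimes> t = t \<otimes> k" by (auto simp: C_def)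
    then show False using t sub by simp
  qed
  obtain d where d: "d \<in> H" "d \<otimes> d = (\<Otimes>a\<in>H. a)" using finprod_subgroup_of_card_4[OF H card] .
  \<comment> \<open>\<open>c\<close> lies in \<open>H\<close>, so that
    \<open>a \<mapsto> c \<otimes> inv a\<close> maps the coset to itself, and its square is the
    product over the coset. Hence the constant \<open>s/2\<close> contributes \<open>c^s\<close> to
    the weight, which cancels the inverse of \<open>c^s\<close> coming from the reflection.\<close>
  define c where "c = t \<otimes> t \<otimes> d"
  have c: "c \<in> H" using t2 d by (simp add: c_def)
  have prodC: "(\<Otimes>a\<in>C. a) = c \<otimes> c"
  proof -
    have "(\<Otimes>a\<in>C. a) = t [^] (4::nat) \<otimes> (d \<otimes> d)"
      unfolding C_def finprod_coset[OF H t(1)] card d(2) ..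
    also have "\<dots> = c \<otimes> c" using t d(1) sub by (simp add: c_def eval_nat_numeral m_ac)
    finally show ?thesis .
  qed
  have refl: "c \<otimes> inv a \<in> C" if "a \<in> C" for a
  proof -
    obtain k where k: "k \<in> H" "a = t \<otimes> k" using \<open>a \<in> C\<close> by (auto simp: C_def)
    have "t \<otimes> (inv (t \<otimes> t) \<otimes> c \<otimes> inv k) = (t \<otimes> inv t) \<otimes> (c \<otimes> (inv t \<otimes> inv k))"
      using k(1) c t(1) sub by (simp only: inv_mult m_ac inv_closed m_closed)
    then have "c \<otimes> inv a = t \<otimes> (inv (t \<otimes> t) \<otimes> c \<otimes> inv k)"
      using k c t(1) sub by (simp add: inv_mult)
    moreover have "inv (t \<otimes> t) \<otimes> c \<otimes> inv k \<in> H" using t2 c k by simp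
    ultimately show ?thesis by (auto simp: C_def)
  qed
  define T :: "('a \<Rightarrow> real) \<Rightarrow> 'a \<Rightarrow> real"
    where "T F a = (if a \<in> H then F a else (\<Sum>b\<in>C. F b) / 2 - F (c \<otimes> inv a))" for F a
  \<comment> \<open>The sum over \<open>C\<close> is 8, so the image has the coordinate
    \<open>4 - 0\<close> or \<open>4 - 8\<close> at \<open>t\<close>, while \<open>x\<close> takes
    only the values 0, 8 and -8.\<close>
  define x where "x a = int N * (single t a - single \<one> a)" for a
  have tC: "t \<in> C" unfolding C_def using t by (intro image_eqI[of _ _ \<one>]) auto
  have cG: "c \<in> carrier G" using c sub by blast
  have notH: "a \<notin> H" if "a \<in> C" for a using that disj by blast
  show ?thesis
  proof (rule not_iso_if_extra[where T = T and x = x and a = t])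
    show "T F a = T F' a" if "\<And>b. b \<in> carrier G \<Longrightarrow> F b = F' b" "a \<in> carrier G" for F F' a
      using that cG Csub by (auto simp: T_def intro!: sum.cong)
    show "T (\<lambda>b. F b + F' b) a = T F a + T F' a" if "a \<in> carrier G" for F F' a
      by (simp add: T_def sum.distrib add_divide_distrib)
    show "T (\<lambda>b. r * F b) a = r * T F a" if "a \<in> carrier G" for r F a
      by (simp add: T_def right_diff_distrib flip: sum_distrib_left)
    show "(\<Sum>a\<in>carrier G. (T F a)\<^sup>2) = (\<Sum>a\<in>carrier G. (F a)\<^sup>2)" for F
    proof -
      define s where "s = (\<Sum>b\<in>C. F b)"
      have "(\<Sum>a\<in>C. (T F a)\<^sup>2) = (\<Sum>a\<in>C. (s / 2 - F (c \<otimes> inv a))\<^sup>2)"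
        by (intro sum.cong) (auto simp: T_def s_def notH)
      also have "\<dots> = (\<Sum>a\<in>C. (s / 2 - F a)\<^sup>2)"
        by (rule sum_point_reflection[OF Csub cG refl])
      \<comment> \<open>As \<open>C\<close> has 4 elements, subtracting \<open>s/2\<close> from
        every coordinate is the orthogonal reflection in the hyperplane of coordinate sum 0;
        \<open>s/2 - F\<close> is its negative.\<close>
      also have "\<dots> = (\<Sum>a\<in>C. s\<^sup>2 / 4 - s * F a + (F a)\<^sup>2)"
        by (intro sum.cong) (auto simp: power2_diff power_divide)
      also have "\<dots> = (\<Sum>a\<in>C. (F a)\<^sup>2)"
        by (simp add: sum.distrib sum_subtractf cardC power2_eq_square s_def flip: sum_distrib_left)
      finally have "(\<Sum>a\<in>C. (T F a)\<^sup>2) = (\<Sum>a\<in>C. (F a)\<^sup>2)" .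
      moreover have "(\<Sum>a\<in>H. (T F a)\<^sup>2) = (\<Sum>a\<in>H. (F a)\<^sup>2)" by (simp add: T_def)
      ultimately show ?thesis by (simp add: un sum.union_disjoint finH finC disj)
    qed
    show "\<exists>y. lattice_fun y \<and> (\<forall>a\<in>carrier G. T (\<lambda>b. real_of_int (x b)) a = real_of_int (y a))"
      if x: "lattice_fun x" for x
    proof -
      define s where "s = (\<Sum>b\<in>C. x b)"
      define W where "W S = (\<Otimes>a\<in>S. a [^] x a)" for S
      have Wc: "W H \<in> carrier G" "W C \<in> carrier G" unfolding W_def using sub Csub by (auto intro!: finprod_closed)
      have W: "W H \<otimes> W C = \<one>"
      proof -
        have "weight x = W H \<otimes> W C"
          unfolding weight_def W_def un using sub Csub by (intro finprod_Un_disjoint finH finC disj) auto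
        then show ?thesis using x by (simp add: lattice_fun_def)
      qed
      \<comment> \<open>Modulo \<open>H\<close> the weight of \<open>x\<close> is
        \<open>t^s\<close>, and \<open>t\<close> has order 2 modulo \<open>H\<close>.\<close>
      have "even s"
      proof (rule ccontr)
        assume "odd s"
        obtain k where k: "k \<in> H" "W C = t [^] s \<otimes> k"
          unfolding W_def s_def C_def by (rule finprod_coset_int_pow[OF H t(1)])
        have "W H \<in> H" unfolding W_def
          by (intro finprod_closed_subgroup H comm_group_axioms) (auto intro: subgroup_int_pow_closed[OF H])
        moreover have "t [^] s = inv (W H) \<otimes> inv k"
        proof -
          have "t [^] s \<otimes> k = inv (W H)" using W k Wc by (metis inv_unique' m_comm)
          then show ?thesis using k t sub Wc by (simp add: inv_solve_right)
        qed
        ultimately have "t [^] s \<in> H" using k by simp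
        moreover have "t [^] (2::int) \<in> H" using t2 t by (simp add: int_pow_def2 eval_nat_numeral)
        ultimately have "t [^] (s mod 2) \<in> H" using int_pow_mod_mem_subgroup[OF H t(1)] by blast
        then show False using \<open>odd s\<close> t by (simp add: odd_iff_mod_2_eq_one)
      qed
      then obtain q where q: "s = 2 * q" by blast
      define y where "y a = (if a \<in> H then x a else q - x (c \<otimes> inv a))" for a
      have "(\<Sum>a\<in>C. y a) = s"
      proof -
        have "(\<Sum>a\<in>C. y a) = (\<Sum>a\<in>C. q - x (c \<otimes> inv a))"
          by (intro sum.cong) (auto simp: y_def notH)
        also have "\<dots> = 4 * q - s"
          using sum_point_reflection[OF Csub cG refl, of x] by (simp add: sum_subtractf cardC s_def)
        finally show ?thesis using q by simp
      qed
      moreover have "(\<Sum>a\<in>H. y a) = (\<Sum>a\<in>H. x a)" by (simp add: y_def)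
      ultimately have "(\<Sum>a\<in>carrier G. y a) = (\<Sum>a\<in>carrier G. x a)"
        by (simp add: un sum.union_disjoint finH finC disj s_def)
      moreover have "weight y = \<one>"
      proof -
        have "weight y = (\<Otimes>a\<in>H. a [^] y a) \<otimes> (\<Otimes>a\<in>C. a [^] y a)"
          unfolding weight_def un using sub Csub by (intro finprod_Un_disjoint finH finC disj) auto
        also have "(\<Otimes>a\<in>H. a [^] y a) = W H"
          unfolding W_def by (intro finprod_cong') (auto simp: y_def sub)
        also have "(\<Otimes>a\<in>C. a [^] y a) = (\<Otimes>a\<in>C. a [^] q \<otimes> inv (a [^] x (c \<otimes> inv a)))"
        proof (intro finprod_cong' refl)
          fix a assume a: "a \<in> C"
          then have "a \<in> carrier G" using Csub by blast
          then show "a [^] y a = a [^] q \<otimes> inv (a [^] x (c \<otimes> inv a))"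
            using notH[OF a] by (simp add: y_def int_pow_diff)
        qed (use Csub in auto)
        also have "\<dots> = (\<Otimes>a\<in>C. a [^] q) \<otimes> (\<Otimes>a\<in>C. inv (a [^] x (c \<otimes> inv a)))"
          using Csub by (intro finprod_multf) auto
        also have "(\<Otimes>a\<in>C. a [^] q) = c [^] s"
          using Csub cG by (subst finprod_int_pow_base) (auto simp: prodC q int_pow_distrib simp flip: int_pow_mult)
        also have "(\<Otimes>a\<in>C. inv (a [^] x (c \<otimes> inv a))) = inv (\<Otimes>a\<in>C. a [^] x (c \<otimes> inv a))"
          using Csub cG by (intro finprod_inv[of "\<lambda>a. a [^] x (c \<otimes> inv a)" C]) auto
        also have "(\<Otimes>a\<in>C. a [^] x (c \<otimes> inv a)) = c [^] s \<otimes> inv (W C)"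
          unfolding W_def s_def by (rule finprod_point_reflection[OF Csub cG refl])
        also have "W H \<otimes> (c [^] s \<otimes> inv (c [^] s \<otimes> inv (W C))) = W H \<otimes> W C"
          using Wc cG by (simp add: inv_mult) (simp flip: m_assoc)
        finally show ?thesis using W by simp
      qed
      moreover have "T (\<lambda>b. real_of_int (x b)) a = real_of_int (y a)" for a
        using q by (simp add: T_def y_def s_def flip: of_int_sum)
      ultimately show ?thesis using x by (intro exI[of _ y]) (simp add: lattice_fun_def)
    qed
    show "lattice_fun x" unfolding x_def using t by (intro lattice_fun_diff_single fin) auto
    show "\<bar>T (\<lambda>b. real_of_int (x b)) t\<bar> \<noteq> \<bar>real_of_int (x b)\<bar>" if "b \<in> carrier G" for b
    proof -
      have "(\<Sum>b\<in>C. x b) = 8 * (\<Sum>b\<in>C. single t b)"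
      proof -
        have "\<one> \<notin> C" using notH H.one_closed by blast
        then show ?thesis unfolding sum_distrib_left
          by (intro sum.cong) (auto simp: x_def N single_def)
      qed
      also have "(\<Sum>b\<in>C. single t b) = 1" using finC tC by (simp add: single_def)
      finally have s: "(\<Sum>b\<in>C. real_of_int (x b)) = 8" by (simp flip: of_int_sum)
      have "c \<otimes> inv t \<noteq> \<one>" using notH[OF refl[OF tC]] H.one_closed by metis
      then show ?thesis using t s by (auto simp: T_def x_def N single_def)
    qed
  qed (use N t in auto)
qed

end

section \<open>Groups of order 9\<close>

context indexed_abelian_group
begin

text \<open>
  The extra automorphism is a point reflection on each of the three cosets of a subgroup of
  order 3, combined with an exchange of the averages over the two nontrivial cosets. These
  averages differ by an integer on \<open>L\<close>.
\<close>

lemma not_iso_9: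
  assumes N: "N = 9"
  shows "\<not> LatticeAutoGroup L \<cong> C2Hol"
proof -
  have cardG: "card (carrier G) = 9" using N by (simp add: order_def)
  obtain H where H: "subgroup H G" and card: "card H = 3"
    using sylow_thm[of 3 G 1 3] fin N is_group by auto
  interpret H: subgroup H G by fact
  have sub: "a \<in> carrier G" if "a \<in> H" for a using that H.subset by blast
  have finH: "finite H" using fin H.subset by (rule rev_finite_subset)
  have "H \<noteq> carrier G" using card cardG by auto
  then obtain t where t: "t \<in> carrier G" "t \<notin> H" using H.subset by blast
  have pow_mod: "t [^] (z mod m) \<in> H" if "t [^] m \<in> H" "t [^] z \<in> H" for m z :: int
    using int_pow_mod_mem_subgroup[OF H t(1) that] .
  have "t [^] (9::int) = \<one>"
    using power_order_eq_one[OF fin t(1)] cardG int_pow_int[of G t 9] by simp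
  then have t9: "t [^] (9::int) \<in> H" by simp
  have t2: "t [^] (2::int) \<notin> H" using pow_mod[of 2 9] t9 t by auto
  define t2 where "t2 = t [^] (2::int)"
  have t2G: "t2 \<in> carrier G" using t by (simp add: t2_def)
  have t2_eq: "t2 = t \<otimes> t" using t by (simp add: t2_def int_pow_def2 eval_nat_numeral)
  define C1 where "C1 = (\<lambda>k. t \<otimes> k) ` H"
  define C2 where "C2 = (\<lambda>k. t2 \<otimes> k) ` H"
  have finC: "finite C1" "finite C2" using finH by (simp_all add: C1_def C2_def)
  have Csub: "C1 \<subseteq> carrier G" "C2 \<subseteq> carrier G" using t t2G H.subset by (auto simp: C1_def C2_def)
  have quot: "u \<otimes> inv v \<in> H" if "u \<in> carrier G" "v \<in> carrier G" "k \<in> H" "k' \<in> H" "u \<otimes> k = v \<otimes> k'" for u v k k'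
  proof -
    have "(u \<otimes> inv v) \<otimes> (k \<otimes> inv k) = (u \<otimes> k) \<otimes> (inv v \<otimes> inv k)"
      using that(1-4) sub by (simp only: m_ac inv_closed m_closed)
    also have "\<dots> = (v \<otimes> inv v) \<otimes> (k' \<otimes> inv k)"
      using that(1-4) sub unfolding that(5) by (simp only: m_ac inv_closed m_closed)
    finally show ?thesis using that sub by simp
  qed
  have disj1: "H \<inter> C1 = {}"
    using quot[of t \<one>] t by (fastforce simp: C1_def)
  have disj2: "H \<inter> C2 = {}"
    using quot[of t2 \<one>] t2 t2G by (fastforce simp: C2_def t2_def[symmetric])
  have disj3: "C1 \<inter> C2 = {}"
  proof (rule ccontr)
    assume "C1 \<inter> C2 \<noteq> {}"
    then obtain k k' where "k \<in> H" "k' \<in> H" "t2 \<otimes> k = t \<otimes> k'" unfolding C1_def C2_def by force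
    then have "t2 \<otimes> inv t \<in> H" using t t2G by (intro quot)
    then show False using t by (simp add: t2_eq m_assoc)
  qed
  have cardC: "card C1 = 3" "card C2 = 3"
    unfolding C1_def C2_def using t t2G sub card by (subst card_image; auto simp: inj_on_def)+
  have un: "carrier G = H \<union> (C1 \<union> C2)"
    using Csub H.subset disj1 disj2 disj3 card cardC cardG fin finH finC
    by (intro card_subset_eq[symmetric]) (auto simp: card_Un_disjoint Int_Un_distrib)
  have disj: "H \<inter> (C1 \<union> C2) = {}" using disj1 disj2 by blast
  have t3: "t [^] (3::int) \<in> H"
  proof (rule ccontr)
    assume "t [^] (3::int) \<notin> H"
    have eq: "t [^] (3::int) = t \<otimes> t2" using t int_pow_mult[of t 1 2] by (simp add: t2_def)
    have "t [^] (3::int) \<in> C1 \<union> C2" using un t \<open>t [^] (3::int) \<notin> H\<close> by (metis UnE int_pow_closed)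
    then show False
    proof
      assume "t [^] (3::int) \<in> C1"
      then obtain k where "k \<in> H" "t \<otimes> t2 = t \<otimes> k" unfolding eq C1_def by blast
      then show False using t(1) t2G sub t2 by (simp add: t2_def[symmetric])
    next
      assume "t [^] (3::int) \<in> C2"
      then obtain k where k: "k \<in> H" "t \<otimes> t2 = t2 \<otimes> k" unfolding eq C2_def by blast
      then have "t2 \<otimes> t = t2 \<otimes> k" using t(1) t2G by (simp add: m_comm)
      then show False using k t t2G sub by simp
    qed
  qed
  \<comment> \<open>The centres \<open>\<one>\<close>, \<open>inv t\<close> and \<open>t\<close>
    keep the three cosets invariant, as \<open>t\<close> has order 3 modulo \<open>H\<close>. They
    add the factor \<open>t^(s2 - s1)\<close> to the weight, with \<open>s1\<close>,
    \<open>s2\<close> the sums over \<open>C1\<close>, \<open>C2\<close>. The exchange of the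
    averages cancels it, because the product over \<open>C2\<close> is \<open>t^3\<close> times that
    over \<open>C1\<close>.\<close>
  have refl0: "\<one> \<otimes> inv a \<in> H" if "a \<in> H" for a using that sub by simp
  have refl1: "inv t \<otimes> inv a \<in> C1" if "a \<in> C1" for a
  proof -
    obtain k where k: "k \<in> H" "a = t \<otimes> k" using \<open>a \<in> C1\<close> by (auto simp: C1_def)
    have "t \<otimes> (inv (t \<otimes> t2) \<otimes> inv k) = (t \<otimes> inv t2) \<otimes> (inv t \<otimes> inv k)"
      using k(1) t(1) t2G sub by (simp only: inv_mult m_ac inv_closed m_closed)
    also have "t \<otimes> inv t2 = inv t" using t(1) by (simp add: t2_eq inv_mult flip: m_assoc)
    finally have "inv t \<otimes> inv a = t \<otimes> (inv (t \<otimes> t2) \<otimes> inv k)"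
      using k t(1) sub by (simp add: inv_mult)
    moreover have "inv (t \<otimes> t2) \<otimes> inv k \<in> H"
      using t3 k t(1) int_pow_mult[of t 1 2] by (simp add: t2_def)
    ultimately show ?thesis by (auto simp: C1_def)
  qed
  have refl2: "t \<otimes> inv a \<in> C2" if "a \<in> C2" for a
  proof -
    obtain k where k: "k \<in> H" "a = t2 \<otimes> k" using \<open>a \<in> C2\<close> by (auto simp: C2_def)
    have "t2 \<otimes> (inv (t \<otimes> t2) \<otimes> inv k) = (t2 \<otimes> inv t) \<otimes> (inv t2 \<otimes> inv k)"
      using k(1) t(1) t2G sub by (simp only: inv_mult m_ac inv_closed m_closed)
    also have "t2 \<otimes> inv t = t" using t(1) by (simp add: t2_eq m_assoc)
    finally have "t \<otimes> inv a = t2 \<otimes> (inv (t \<otimes> t2) \<otimes> inv k)"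
      using k t2G sub by (simp add: inv_mult)
    moreover have "inv (t \<otimes> t2) \<otimes> inv k \<in> H"
      using t3 k t(1) int_pow_mult[of t 1 2] by (simp add: t2_def)
    ultimately show ?thesis by (auto simp: C2_def)
  qed
  have notH: "a \<notin> H" if "a \<in> C1 \<union> C2" for a using that disj by blast
  have notC1: "a \<notin> C1" if "a \<in> C2" for a using that disj3 by blast
  have cG: "\<one> \<in> carrier G" "inv t \<in> carrier G" "t \<in> carrier G" using t by auto
  define T :: "('a \<Rightarrow> real) \<Rightarrow> 'a \<Rightarrow> real"
    where "T F a = (if a \<in> H then F (\<one> \<otimes> inv a)
      else if a \<in> C1 then F (inv t \<otimes> inv a) + ((\<Sum>b\<in>C2. F b) - (\<Sum>b\<in>C1. F b)) / 3
      else F (t \<otimes> inv a) - ((\<Sum>b\<in>C2. F b) - (\<Sum>b\<in>C1. F b)) / 3)" for F a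
  \<comment> \<open>The sums over \<open>C1\<close> and \<open>C2\<close> are 9 and 0, so the
    averages differ by 3. As \<open>x\<close> vanishes on \<open>C2\<close>, its image is 3 there,
    whereas \<open>x\<close> takes only the values 0, 9 and -9.\<close>
  define x where "x a = int N * (single t a - single \<one> a)" for a
  have tC: "t \<in> C1" unfolding C1_def using t by (intro image_eqI[of _ _ \<one>]) auto
  have t2C: "t2 \<in> C2" unfolding C2_def using t2G by (intro image_eqI[of _ _ \<one>]) auto
  show ?thesis
  proof (rule not_iso_if_extra[where T = T and x = x and a = t2])
    show "T F a = T F' a" if F: "\<And>b. b \<in> carrier G \<Longrightarrow> F b = F' b" and "a \<in> carrier G" for F F' a
    proof -
      have "(\<Sum>b\<in>C1. F b) = (\<Sum>b\<in>C1. F' b)" "(\<Sum>b\<in>C2. F b) = (\<Sum>b\<in>C2. F' b)"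
        using Csub F by (auto intro!: sum.cong)
      then show ?thesis using \<open>a \<in> carrier G\<close> cG F by (simp add: T_def)
    qed
    show "T (\<lambda>b. F b + F' b) a = T F a + T F' a" if "a \<in> carrier G" for F F' a
      by (simp add: T_def sum.distrib field_simps)
    show "T (\<lambda>b. r * F b) a = r * T F a" if "a \<in> carrier G" for r F a
      by (simp add: T_def algebra_simps flip: sum_distrib_left)
    show "(\<Sum>a\<in>carrier G. (T F a)\<^sup>2) = (\<Sum>a\<in>carrier G. (F a)\<^sup>2)" for F
    proof -
      define s1 where "s1 = (\<Sum>b\<in>C1. F b)"
      define s2 where "s2 = (\<Sum>b\<in>C2. F b)"
      define d where "d = (s2 - s1) / 3"
      have "(\<Sum>a\<in>H. (T F a)\<^sup>2) = (\<Sum>a\<in>H. (F (\<one> \<otimes> inv a))\<^sup>2)"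
        by (intro sum.cong) (auto simp: T_def)
      also have "\<dots> = (\<Sum>a\<in>H. (F a)\<^sup>2)" by (rule sum_point_reflection[OF H.subset cG(1) refl0])
      finally have e0: "(\<Sum>a\<in>H. (T F a)\<^sup>2) = (\<Sum>a\<in>H. (F a)\<^sup>2)" .
      have "(\<Sum>a\<in>C1. (T F a)\<^sup>2) = (\<Sum>a\<in>C1. (F (inv t \<otimes> inv a) + d)\<^sup>2)"
        by (intro sum.cong) (auto simp: T_def notH d_def s1_def s2_def)
      also have "\<dots> = (\<Sum>a\<in>C1. (F a + d)\<^sup>2)" by (rule sum_point_reflection[OF Csub(1) cG(2) refl1])
      also have "\<dots> = (\<Sum>a\<in>C1. (F a)\<^sup>2 + 2 * d * F a + d\<^sup>2)"
        by (intro sum.cong) (auto simp: power2_sum)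
      also have "\<dots> = (\<Sum>a\<in>C1. (F a)\<^sup>2) + 2 * d * s1 + 3 * d\<^sup>2"
        by (simp add: sum.distrib cardC s1_def flip: sum_distrib_left)
      finally have e1: "(\<Sum>a\<in>C1. (T F a)\<^sup>2) = (\<Sum>a\<in>C1. (F a)\<^sup>2) + 2 * d * s1 + 3 * d\<^sup>2" .
      have "(\<Sum>a\<in>C2. (T F a)\<^sup>2) = (\<Sum>a\<in>C2. (F (t \<otimes> inv a) - d)\<^sup>2)"
        by (intro sum.cong) (auto simp: T_def notH notC1 d_def s1_def s2_def)
      also have "\<dots> = (\<Sum>a\<in>C2. (F a - d)\<^sup>2)" by (rule sum_point_reflection[OF Csub(2) cG(3) refl2])
      also have "\<dots> = (\<Sum>a\<in>C2. (F a)\<^sup>2 - 2 * d * F a + d\<^sup>2)"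
        by (intro sum.cong) (auto simp: power2_diff)
      also have "\<dots> = (\<Sum>a\<in>C2. (F a)\<^sup>2) - 2 * d * s2 + 3 * d\<^sup>2"
        by (simp add: sum.distrib sum_subtractf cardC s2_def flip: sum_distrib_left)
      finally have e2: "(\<Sum>a\<in>C2. (T F a)\<^sup>2) = (\<Sum>a\<in>C2. (F a)\<^sup>2) - 2 * d * s2 + 3 * d\<^sup>2" .
      have "3 * d = s2 - s1" by (simp add: d_def)
      then have "s2 = s1 + 3 * d" by simp
      then have "2 * d * s1 + 3 * d\<^sup>2 - 2 * d * s2 + 3 * d\<^sup>2 = 0"
        by (simp add: power2_eq_square algebra_simps)
      with e0 e1 e2 show ?thesis
        by (simp add: un sum.union_disjoint finH finC disj disj3)
    qed
    show "\<exists>y. lattice_fun y \<and> (\<forall>a\<in>carrier G. T (\<lambda>b. real_of_int (x b)) a = real_of_int (y a))"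
      if x: "lattice_fun x" for x
    proof -
      define s1 where "s1 = (\<Sum>b\<in>C1. x b)"
      define s2 where "s2 = (\<Sum>b\<in>C2. x b)"
      define W where "W S = (\<Otimes>a\<in>S. a [^] x a)" for S
      have Wc: "W H \<in> carrier G" "W C1 \<in> carrier G" "W C2 \<in> carrier G"
        unfolding W_def using sub Csub by (auto intro!: finprod_closed)
      have split: "finprod G f (carrier G) = finprod G f H \<otimes> (finprod G f C1 \<otimes> finprod G f C2)"
        if "f \<in> carrier G \<rightarrow> carrier G" for f
      proof -
        have f: "f \<in> H \<rightarrow> carrier G" "f \<in> C1 \<rightarrow> carrier G" "f \<in> C2 \<rightarrow> carrier G"
          using that sub Csub by blast+
        have "finprod G f (H \<union> (C1 \<union> C2)) = finprod G f H \<otimes> finprod G f (C1 \<union> C2)"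
          using f finH finC disj by (intro finprod_Un_disjoint) auto
        also have "finprod G f (C1 \<union> C2) = finprod G f C1 \<otimes> finprod G f C2"
          using f finC disj3 by (intro finprod_Un_disjoint) auto
        finally show ?thesis by (simp flip: un)
      qed
      have W: "W H \<otimes> (W C1 \<otimes> W C2) = \<one>"
        using split[of "\<lambda>a. a [^] x a"] x by (simp add: W_def lattice_fun_def weight_def Pi_iff)
      \<comment> \<open>Modulo \<open>H\<close> the weight of \<open>x\<close> is
        \<open>t^(s1 + 2 s2)\<close>, and \<open>s1 + 2 s2\<close> is congruent to
        \<open>s1 - s2\<close> modulo 3.\<close>
      have "3 dvd s2 - s1"
      proof -
        obtain k1 where k1: "k1 \<in> H" "W C1 = t [^] s1 \<otimes> k1"
          unfolding W_def s1_def C1_def by (rule finprod_coset_int_pow[OF H t(1)])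
        obtain k2 where k2: "k2 \<in> H" "W C2 = t2 [^] s2 \<otimes> k2"
          unfolding W_def s2_def C2_def by (rule finprod_coset_int_pow[OF H t2G])
        have WH: "W H \<in> H" unfolding W_def
          by (intro finprod_closed_subgroup H comm_group_axioms) (auto intro: subgroup_int_pow_closed[OF H])
        have "t2 [^] s2 = t [^] (2 * s2)" using t by (simp add: t2_def int_pow_pow)
        then have "t [^] (s1 + 2 * s2) = t [^] s1 \<otimes> t2 [^] s2" using t by (simp add: int_pow_mult)
        moreover have "(t [^] s1 \<otimes> t2 [^] s2) \<otimes> (W H \<otimes> k1 \<otimes> k2) = W H \<otimes> (W C1 \<otimes> W C2)"
          unfolding k1(2) k2(2) using k1(1) k2(1) sub t(1) t2G Wc(1)
          by (simp only: m_ac int_pow_closed m_closed)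
        ultimately have "t [^] (s1 + 2 * s2) \<otimes> (W H \<otimes> k1 \<otimes> k2) = \<one> \<otimes> \<one>" using W by simp
        then have "t [^] (s1 + 2 * s2) \<otimes> inv \<one> \<in> H"
          using WH k1 k2 t by (intro quot[of _ _ "W H \<otimes> k1 \<otimes> k2" \<one>]) auto
        then have "t [^] (s1 + 2 * s2) \<in> H" using t by simp
        from pow_mod[OF t3 this] have "t [^] ((s1 + 2 * s2) mod 3) \<in> H" .
        moreover have "(s1 + 2 * s2) mod 3 \<in> {0, 1, 2}" by auto
        ultimately have "(s1 + 2 * s2) mod 3 = 0" using t t2 by auto
        then show ?thesis by presburger
      qed
      then obtain d where d: "s2 - s1 = 3 * d" by blast
      define y where "y a = (if a \<in> H then x (\<one> \<otimes> inv a) else if a \<in> C1 then x (inv t \<otimes> inv a) + d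
        else x (t \<otimes> inv a) - d)" for a
      have "(\<Sum>a\<in>H. y a) = (\<Sum>a\<in>H. x (\<one> \<otimes> inv a))" by (intro sum.cong) (auto simp: y_def)
      also have "\<dots> = (\<Sum>a\<in>H. x a)" by (rule sum_point_reflection[OF H.subset cG(1) refl0])
      finally have e0: "(\<Sum>a\<in>H. y a) = (\<Sum>a\<in>H. x a)" .
      have "(\<Sum>a\<in>C1. y a) = (\<Sum>a\<in>C1. x (inv t \<otimes> inv a) + d)" by (intro sum.cong) (auto simp: y_def notH)
      also have "\<dots> = (\<Sum>a\<in>C1. x a + d)" by (rule sum_point_reflection[OF Csub(1) cG(2) refl1])
      finally have e1: "(\<Sum>a\<in>C1. y a) = s1 + 3 * d" by (simp add: sum.distrib cardC s1_def)
      have "(\<Sum>a\<in>C2. y a) = (\<Sum>a\<in>C2. x (t \<otimes> inv a) - d)" by (intro sum.cong) (auto simp: y_def notH notC1)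
      also have "\<dots> = (\<Sum>a\<in>C2. x a - d)" by (rule sum_point_reflection[OF Csub(2) cG(3) refl2])
      finally have e2: "(\<Sum>a\<in>C2. y a) = s2 - 3 * d" by (simp add: sum_subtractf cardC s2_def)
      have "(\<Sum>a\<in>carrier G. y a) = (\<Sum>a\<in>carrier G. x a)"
        using e0 e1 e2 by (simp add: un sum.union_disjoint finH finC disj disj3 s1_def s2_def)
      moreover have "weight y = \<one>"
      proof -
        define P1 where "P1 = (\<Otimes>a\<in>C1. a)"
        define P2 where "P2 = (\<Otimes>a\<in>C2. a)"
        have Pc: "P1 \<in> carrier G" "P2 \<in> carrier G" unfolding P1_def P2_def using Csub by (auto intro!: finprod_closed)
        have P: "P2 = t [^] (3::int) \<otimes> P1"
        proof -
          have "t [^] (3::nat) \<in> carrier G" "t2 [^] (3::nat) = t [^] (3::nat) \<otimes> t [^] (3::nat)"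
            using t by (simp_all add: t2_eq pow_mult_distrib m_comm)
          moreover have "(\<Otimes>a\<in>H. a) \<in> carrier G" using sub by (auto intro!: finprod_closed)
          moreover have "t [^] (3::int) = t [^] (3::nat)" using int_pow_int[of G t 3] by simp
          ultimately show ?thesis
            unfolding P1_def P2_def C1_def C2_def finprod_coset[OF H t(1)] finprod_coset[OF H t2G] card
            by (simp add: m_assoc)
        qed
        have w0: "(\<Otimes>a\<in>H. a [^] y a) = inv (W H)"
        proof -
          have "(\<Otimes>a\<in>H. a [^] y a) = (\<Otimes>a\<in>H. a [^] x (\<one> \<otimes> inv a))"
            by (intro finprod_cong') (auto simp: y_def sub)
          also have "\<dots> = \<one> [^] (\<Sum>a\<in>H. x a) \<otimes> inv (W H)"
            unfolding W_def by (rule finprod_point_reflection[OF H.subset cG(1) refl0])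
          finally show ?thesis using Wc by simp
        qed
        have w1: "(\<Otimes>a\<in>C1. a [^] y a) = inv t [^] s1 \<otimes> inv (W C1) \<otimes> P1 [^] d"
        proof -
          have "(\<Otimes>a\<in>C1. a [^] y a) = (\<Otimes>a\<in>C1. a [^] x (inv t \<otimes> inv a) \<otimes> a [^] d)"
          proof (intro finprod_cong' refl)
            fix a assume a: "a \<in> C1"
            then show "a [^] y a = a [^] x (inv t \<otimes> inv a) \<otimes> a [^] d"
              using Csub notH[of a] by (simp add: y_def int_pow_mult subset_iff)
          qed (use Csub in auto)
          also have "\<dots> = (\<Otimes>a\<in>C1. a [^] x (inv t \<otimes> inv a)) \<otimes> (\<Otimes>a\<in>C1. a [^] d)"
            using Csub by (intro finprod_multf) auto
          also have "(\<Otimes>a\<in>C1. a [^] d) = P1 [^] d"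
            unfolding P1_def using Csub by (intro finprod_int_pow_base) auto
          also have "(\<Otimes>a\<in>C1. a [^] x (inv t \<otimes> inv a)) = inv t [^] s1 \<otimes> inv (W C1)"
            unfolding W_def s1_def by (rule finprod_point_reflection[OF Csub(1) cG(2) refl1])
          finally show ?thesis .
        qed
        have w2: "(\<Otimes>a\<in>C2. a [^] y a) = t [^] s2 \<otimes> inv (W C2) \<otimes> P2 [^] (- d)"
        proof -
          have "(\<Otimes>a\<in>C2. a [^] y a) = (\<Otimes>a\<in>C2. a [^] x (t \<otimes> inv a) \<otimes> a [^] (- d))"
          proof (intro finprod_cong' refl)
            fix a assume a: "a \<in> C2"
            then have "a \<in> carrier G" using Csub by blast
            then show "a [^] y a = a [^] x (t \<otimes> inv a) \<otimes> a [^] (- d)"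
              using a notH[of a] notC1[of a] by (simp add: y_def flip: int_pow_mult)
          qed (use Csub in auto)
          also have "\<dots> = (\<Otimes>a\<in>C2. a [^] x (t \<otimes> inv a)) \<otimes> (\<Otimes>a\<in>C2. a [^] (- d))"
            using Csub by (intro finprod_multf) auto
          also have "(\<Otimes>a\<in>C2. a [^] (- d)) = P2 [^] (- d)"
            unfolding P2_def using Csub by (intro finprod_int_pow_base) auto
          also have "(\<Otimes>a\<in>C2. a [^] x (t \<otimes> inv a)) = t [^] s2 \<otimes> inv (W C2)"
            unfolding W_def s2_def by (rule finprod_point_reflection[OF Csub(2) cG(3) refl2])
          finally show ?thesis .
        qed
        have P2d: "P2 [^] (- d) = t [^] (- (3 * d)) \<otimes> P1 [^] (- d)"
          using t Pc by (simp add: P int_pow_distrib int_pow_pow)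
        have "weight y = inv (W H) \<otimes> ((inv t [^] s1 \<otimes> inv (W C1) \<otimes> P1 [^] d)
            \<otimes> (t [^] s2 \<otimes> inv (W C2) \<otimes> (t [^] (- (3 * d)) \<otimes> P1 [^] (- d))))"
          unfolding weight_def P2d[symmetric] w0[symmetric] w1[symmetric] w2[symmetric] by (rule split) auto
        also have "\<dots> = (inv (W H) \<otimes> (inv (W C1) \<otimes> inv (W C2)))
            \<otimes> ((inv t [^] s1 \<otimes> t [^] s2 \<otimes> t [^] (- (3 * d))) \<otimes> (P1 [^] d \<otimes> P1 [^] (- d)))"
          using Wc Pc t(1) by (simp only: m_ac m_closed inv_closed int_pow_closed)
        also have "P1 [^] d \<otimes> P1 [^] (- d) = \<one>" using Pc by (simp flip: int_pow_mult)
        also have "inv t [^] s1 \<otimes> t [^] s2 \<otimes> t [^] (- (3 * d)) = t [^] (- s1 + s2 + - (3 * d))"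
          using t(1) by (simp only: int_pow_mult int_pow_neg int_pow_inv)
        also have "- s1 + s2 + - (3 * d) = 0" using d by simp
        also have "inv (W H) \<otimes> (inv (W C1) \<otimes> inv (W C2)) = inv (W H \<otimes> (W C1 \<otimes> W C2))"
          using Wc by (simp add: inv_mult)
        finally show ?thesis using W by simp
      qed
      moreover have "T (\<lambda>b. real_of_int (x b)) a = real_of_int (y a)" for a
      proof -
        have "((\<Sum>b\<in>C2. real_of_int (x b)) - (\<Sum>b\<in>C1. real_of_int (x b))) / 3 = real_of_int d"
          using d by (simp add: s1_def s2_def flip: of_int_sum of_int_diff)
        then show ?thesis by (simp only: T_def y_def of_int_add of_int_diff split: if_split) simp
      qed
      ultimately show ?thesis using x by (intro exI[of _ y]) (simp add: lattice_fun_def)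
    qed
    show "lattice_fun x" unfolding x_def using t by (intro lattice_fun_diff_single fin) auto
    show "\<bar>T (\<lambda>b. real_of_int (x b)) t2\<bar> \<noteq> \<bar>real_of_int (x b)\<bar>" if "b \<in> carrier G" for b
    proof -
      have one: "\<one> \<notin> C1" "\<one> \<notin> C2" using notH H.one_closed by blast+
      have "(\<Sum>b\<in>C1. x b) = 9 * (\<Sum>b\<in>C1. single t b)"
        unfolding sum_distrib_left using one by (intro sum.cong) (auto simp: x_def N single_def)
      also have "(\<Sum>b\<in>C1. single t b) = 1" using finC tC by (simp add: single_def)
      finally have s1: "(\<Sum>b\<in>C1. real_of_int (x b)) = 9" by (simp flip: of_int_sum)
      have "(\<Sum>b\<in>C2. x b) = (\<Sum>b\<in>C2. 0)"
        using one notC1 tC by (intro sum.cong) (auto simp: x_def N single_def)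
      then have s2: "(\<Sum>b\<in>C2. real_of_int (x b)) = 0" by (simp flip: of_int_sum)
      have "t \<otimes> inv t2 \<in> C2" using refl2[OF t2C] .
      then have "x (t \<otimes> inv t2) = 0" using one notC1 tC by (auto simp: x_def single_def)
      then have "T (\<lambda>b. real_of_int (x b)) t2 = 3"
        using notH[of t2] notC1[OF t2C] t2C s1 s2 by (simp add: T_def)
      moreover have "x b \<in> {0, 9, -9}" by (simp add: x_def N single_def)
      ultimately show ?thesis by auto
    qed
  qed (use N t2G in auto)
qed

end

section \<open>Cyclic groups: orders 5, 7, 10 and 11\<close>

context comm_group
begin

lemma bij_powers:
  assumes "finite (carrier G)" "c \<in> carrier G" "ord c = order G"
  shows "bij_betw (\<lambda>k. c [^] (k::nat)) {..<order G} (carrier G)"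
proof -
  have pos: "order G > 0" using assms(1) by (simp add: order_gt_0_iff_finite)
  have "{..<order G} = {0..order G - 1}" using pos by auto
  then have inj: "inj_on (\<lambda>k. c [^] (k::nat)) {..<order G}" using ord_inj[OF assms(2)] assms(3) by simp
  moreover have "(\<lambda>k. c [^] (k::nat)) ` {..<order G} = carrier G"
    using assms inj by (intro card_subset_eq) (auto simp: card_image order_def)
  ultimately show ?thesis by (simp add: bij_betw_def)
qed

lemma prime_order_generator:
  assumes "finite (carrier G)" "prime (order G)"
  obtains c where "c \<in> carrier G" "ord c = order G"
proof -
  have "card (carrier G) > 1" using prime_gt_1_nat[OF assms(2)] by (simp add: order_def)
  then have "\<not> carrier G \<subseteq> {\<one>}" using card_mono[of "{\<one>}" "carrier G"] by auto
  then obtain c where c: "c \<in> carrier G" "c \<noteq> \<one>" by blast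
  have "ord c dvd order G" using assms(1) c by (intro ord_dvd_group_order)
  moreover have "ord c \<noteq> 1" using c ord_eq_1 by blast
  ultimately show ?thesis using assms(2) c that unfolding prime_nat_iff by blast
qed

text \<open>Multiply elements of order 2 and 5: the order of the product divides 10 but neither 2
  nor 5.\<close>

lemma order_10_generator:
  assumes fin: "finite (carrier G)" and N: "order G = 10"
  obtains c where "c \<in> carrier G" "ord c = order G"
proof -
  obtain H where H: "subgroup H G" "card H = 2"
    using sylow_thm[of 2 G 1 5] fin N is_group by auto
  obtain K where K: "subgroup K G" "card K = 5"
    using sylow_thm[of 5 G 1 2] fin N is_group by auto
  have finHK: "finite H" "finite K" using H K by (auto intro: card_ge_0_finite)
  have "\<not> H \<subseteq> {\<one>}" using H card_mono[of "{\<one>}" H] by auto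
  then obtain a where a: "a \<in> H" "a \<noteq> \<one>" by blast
  have "\<not> K \<subseteq> {\<one>}" using K card_mono[of "{\<one>}" K] by auto
  then obtain b where b: "b \<in> K" "b \<noteq> \<one>" by blast
  have aG: "a \<in> carrier G" using a H subgroup.subset by blast
  have bG: "b \<in> carrier G" using b K subgroup.subset by blast
  have a2: "a [^] (2::nat) = \<one>" using subgroup_pow_card[OF H(1) finHK(1) a(1)] H(2) by simp
  have b5: "b [^] (5::nat) = \<one>" using subgroup_pow_card[OF K(1) finHK(2) b(1)] K(2) by simp
  have oa: "ord a = 2"
  proof -
    have "ord a dvd 2" using a2 aG by (simp add: pow_eq_id)
    then have "ord a = 1 \<or> ord a = 2" using two_is_prime_nat by (simp add: prime_nat_iff)
    then show ?thesis using a aG ord_eq_1 by blast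
  qed
  have ob: "ord b = 5"
  proof -
    have "ord b dvd 5" using b5 bG by (simp add: pow_eq_id)
    moreover have "prime (5::nat)" by simp
    ultimately have "ord b = 1 \<or> ord b = 5" unfolding prime_nat_iff by blast
    then show ?thesis using b bG ord_eq_1 by blast
  qed
  have c: "a \<otimes> b \<in> carrier G" using aG bG by simp
  have "ord (a \<otimes> b) dvd 10" using ord_dvd_group_order[OF c] N fin by simp
  have "(a \<otimes> b) [^] (2::nat) = b [^] (2::nat)" using aG bG a2 by (simp add: pow_mult_distrib m_comm)
  then have n2: "\<not> ord (a \<otimes> b) dvd 2" using c bG ob by (simp add: pow_eq_id[symmetric]) (simp add: pow_eq_id)
  have "a [^] (5::nat) = a [^] (2::nat) \<otimes> a [^] (2::nat) \<otimes> a" using aG by (simp add: eval_nat_numeral m_assoc)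
  then have "(a \<otimes> b) [^] (5::nat) = a" using aG bG a2 b5 by (simp add: pow_mult_distrib m_comm)
  then have n5: "\<not> ord (a \<otimes> b) dvd 5" using c a by (simp add: pow_eq_id[symmetric])
  have "ord (a \<otimes> b) = 10"
  proof -
    have "ord (a \<otimes> b) \<le> 10" using \<open>ord (a \<otimes> b) dvd 10\<close> by (auto dest: dvd_imp_le)
    then have "ord (a \<otimes> b) \<in> {0,1,2,3,4,5,6,7,8,9,10}" unfolding insert_iff empty_iff by presburger
    then show ?thesis using \<open>ord (a \<otimes> b) dvd 10\<close> n2 n5 by auto
  qed
  then show ?thesis using c that N by simp
qed

end

lemma sum_lessThan_swap_weighted:
  fixes B :: "nat \<Rightarrow> nat \<Rightarrow> int"
  shows "(\<Sum>j<N. w j * (\<Sum>i<N. B i j * X i)) = (\<Sum>i<N. X i * (\<Sum>j<N. w j * B i j))"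
proof -
  have "(\<Sum>j<N. w j * (\<Sum>i<N. B i j * X i)) = (\<Sum>j<N. \<Sum>i<N. X i * (w j * B i j))"
    by (simp add: sum_distrib_left mult_ac)
  also have "\<dots> = (\<Sum>i<N. X i * (\<Sum>j<N. w j * B i j))"
    by (subst sum.swap) (simp add: sum_distrib_left)
  finally show ?thesis .
qed

context indexed_abelian_group
begin

text \<open>\<open>T\<close> is given by the matrix \<open>B / M\<close> in the coordinates indexed
  by the exponents of \<open>c\<close>. \<open>cong\<close> makes the image integral, because the
  sum of \<open>i x_i\<close> is a multiple of \<open>N\<close> and hence of \<open>M\<close>.
  \<open>rowsum\<close> preserves the coordinate sum, \<open>moment\<close> multiplies the weight,
  as an exponent of \<open>c\<close>, by \<open>\<alpha>\<close>, and \<open>orth\<close> makes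
  \<open>T\<close> an isometry. By \<open>B01\<close> the image of \<open>N (e_c - e_1)\<close> has
  the coordinate \<open>N / M\<close> at \<open>c\<close>, strictly between 0 and
  \<open>N\<close>.\<close>

lemma not_iso_cyclic:
  fixes B :: "nat \<Rightarrow> nat \<Rightarrow> int" and M \<alpha> :: int
  assumes N3: "N \<ge> 3" and c: "c \<in> carrier G" "ord c = N"
    and M: "M > 1" "M dvd int N"
    and cong: "\<And>i j. i < N \<Longrightarrow> j < N \<Longrightarrow> M dvd B i j - int (i * j)"
    and rowsum: "\<And>i. i < N \<Longrightarrow> (\<Sum>j<N. B i j) = M"
    and moment: "\<And>i. i < N \<Longrightarrow> int N * M dvd (\<Sum>j<N. int j * B i j) - M * \<alpha> * int i"
    and orth: "\<And>i k. i < N \<Longrightarrow> k < N \<Longrightarrow> (\<Sum>j<N. B i j * B k j) = (if i = k then M\<^sup>2 else 0)"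
    and B01: "B 0 1 = 0" "B 1 1 = 1"
  shows "\<not> LatticeAutoGroup L \<cong> C2Hol"
proof -
  define e where "e k = c [^] (k::nat)" for k
  have bije: "bij_betw e {..<N} (carrier G)" unfolding e_def using fin c by (rule bij_powers)
  have eG: "e k \<in> carrier G" for k using c by (simp add: e_def)
  have sum_e: "(\<Sum>a\<in>carrier G. F a) = (\<Sum>k<N. F (e k))" for F :: "'a \<Rightarrow> 'c::comm_monoid_add"
    using sum.reindex_bij_betw[OF bije, of F] by simp
  have weight_e: "weight x = c [^] (\<Sum>k<N. int k * x (e k))" for x
  proof -
    have "weight x = (\<Otimes>k\<in>{..<N}. e k [^] x (e k))"
      unfolding weight_def using bije by (rule finprod_reindex_bij) auto
    also have "\<dots> = (\<Otimes>k\<in>{..<N}. c [^] (int k * x (e k)))"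
      using c by (intro finprod_cong') (auto simp: e_def int_pow_pow simp flip: int_pow_int)
    finally show ?thesis using c by (simp add: finprod_int_pow_sum)
  qed
  have pow_one: "c [^] (z::int) = \<one> \<longleftrightarrow> int N dvd z" for z
    using c by (simp add: int_pow_eq_id)
  have lattice_fun_e: "lattice_fun x \<longleftrightarrow> (\<Sum>k<N. x (e k)) = 0 \<and> int N dvd (\<Sum>k<N. int k * x (e k))" for x
    by (simp add: lattice_fun_def sum_e weight_e pow_one)
  define ix where "ix = inv_into {..<N} e"
  have ix_e: "ix (e k) = k" if "k < N" for k
    unfolding ix_def using bije that by (simp add: bij_betw_def)
  have e_ix: "e (ix a) = a" "ix a < N" if "a \<in> carrier G" for a
    unfolding ix_def using bij_betw_inv_into_right[OF bije that] inv_into_into[of a e "{..<N}"] bije that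
    by (auto simp: bij_betw_def)
  define T :: "('a \<Rightarrow> real) \<Rightarrow> 'a \<Rightarrow> real"
    where "T F a = (\<Sum>i<N. real_of_int (B i (ix a)) * F (e i)) / real_of_int M" for F a
  define x where "x a = int N * (single (e 1) a - single \<one> a)" for a
  have Mpos: "real_of_int M > 0" using M by simp
  show ?thesis
  proof (rule not_iso_if_extra[where T = T and x = x and a = "e 1"])
    show "T F a = T F' a" if "\<And>b. b \<in> carrier G \<Longrightarrow> F b = F' b" "a \<in> carrier G" for F F' a
      using that eG by (simp add: T_def)
    show "T (\<lambda>b. F b + F' b) a = T F a + T F' a" if "a \<in> carrier G" for F F' a
      by (simp add: T_def distrib_left sum.distrib add_divide_distrib)
    show "T (\<lambda>b. r * F b) a = r * T F a" if "a \<in> carrier G" for r F a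
      by (simp add: T_def sum_distrib_left mult.left_commute)
    show "(\<Sum>a\<in>carrier G. (T F a)\<^sup>2) = (\<Sum>a\<in>carrier G. (F a)\<^sup>2)" for F
    proof -
      have "(\<Sum>a\<in>carrier G. (T F a)\<^sup>2) = (\<Sum>j<N. ((\<Sum>i<N. real_of_int (B i j) * F (e i)) / real_of_int M)\<^sup>2)"
        unfolding sum_e by (intro sum.cong) (auto simp: T_def ix_e)
      also have "\<dots> = (\<Sum>j<N. \<Sum>i<N. \<Sum>k<N. F (e i) * F (e k) * real_of_int (B i j * B k j)) / (real_of_int M)\<^sup>2"
        unfolding power_divide sum_divide_distrib[symmetric]
        by (simp add: power2_eq_square sum_product mult_ac)
      also have "(\<Sum>j<N. \<Sum>i<N. \<Sum>k<N. F (e i) * F (e k) * real_of_int (B i j * B k j))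
          = (\<Sum>i<N. \<Sum>k<N. F (e i) * F (e k) * real_of_int (\<Sum>j<N. B i j * B k j))"
      proof -
        have "(\<Sum>j<N. \<Sum>i<N. \<Sum>k<N. F (e i) * F (e k) * real_of_int (B i j * B k j))
          = (\<Sum>i<N. \<Sum>j<N. \<Sum>k<N. F (e i) * F (e k) * real_of_int (B i j * B k j))" by (rule sum.swap)
        also have "\<dots> = (\<Sum>i<N. \<Sum>k<N. \<Sum>j<N. F (e i) * F (e k) * real_of_int (B i j * B k j))"
          by (intro sum.cong refl sum.swap)
        finally show ?thesis by (simp only: of_int_sum sum_distrib_left)
      qed
      also have "\<dots> = (\<Sum>i<N. \<Sum>k<N. if i = k then (F (e i))\<^sup>2 * (real_of_int M)\<^sup>2 else 0)"
        by (intro sum.cong refl) (simp add: orth power2_eq_square)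
      also have "\<dots> = (\<Sum>i<N. (F (e i))\<^sup>2) * (real_of_int M)\<^sup>2" by (simp add: sum_distrib_right)
      finally show ?thesis using Mpos by (simp add: sum_e)
    qed
    show "\<exists>y. lattice_fun y \<and> (\<forall>a\<in>carrier G. T (\<lambda>b. real_of_int (x b)) a = real_of_int (y a))"
      if x: "lattice_fun x" for x
    proof -
      define X where "X k = x (e k)" for k
      have X0: "(\<Sum>k<N. X k) = 0" and X1: "int N dvd (\<Sum>k<N. int k * X k)"
        using x by (simp_all add: lattice_fun_e X_def)
      define Y where "Y j = (\<Sum>i<N. B i j * X i)" for j
      have MY: "M dvd Y j" if j: "j < N" for j
      proof -
        have "Y j = (\<Sum>i<N. (B i j - int (i * j)) * X i) + int j * (\<Sum>i<N. int i * X i)"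
          unfolding Y_def sum_distrib_left sum.distrib[symmetric]
          by (intro sum.cong) (auto simp: algebra_simps)
        moreover have "M dvd (\<Sum>i<N. (B i j - int (i * j)) * X i)"
          using cong j by (intro dvd_sum dvd_mult2) auto
        moreover have "M dvd (\<Sum>i<N. int i * X i)" using M(2) X1 by (rule dvd_trans)
        ultimately show ?thesis by simp
      qed
      define y where "y a = Y (ix a) div M" for a
      have y_e: "M * y (e j) = Y j" if "j < N" for j using MY[OF that] that by (simp add: y_def ix_e)
      have "M * (\<Sum>j<N. y (e j)) = (\<Sum>j<N. 1 * Y j)" by (simp add: sum_distrib_left y_e)
      also have "\<dots> = (\<Sum>i<N. X i * (\<Sum>j<N. 1 * B i j))"
        unfolding Y_def by (rule sum_lessThan_swap_weighted)
      also have "\<dots> = (\<Sum>i<N. X i) * M" by (simp add: rowsum sum_distrib_right)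
      finally have y0: "(\<Sum>j<N. y (e j)) = 0" using X0 M by simp
      define R where "R i = (\<Sum>j<N. int j * B i j)" for i
      have "M * (\<Sum>j<N. int j * y (e j)) = (\<Sum>j<N. int j * (M * y (e j)))"
        by (simp add: sum_distrib_left mult_ac)
      also have "\<dots> = (\<Sum>j<N. int j * Y j)" by (simp add: y_e)
      also have "\<dots> = (\<Sum>i<N. X i * R i)"
        unfolding Y_def R_def by (rule sum_lessThan_swap_weighted)
      also have "\<dots> = (\<Sum>i<N. X i * (R i - M * \<alpha> * int i)) + M * (\<alpha> * (\<Sum>i<N. int i * X i))"
        unfolding sum_distrib_left sum.distrib[symmetric]
        by (intro sum.cong) (auto simp: algebra_simps)
      finally have e1: "M * (\<Sum>j<N. int j * y (e j)) =
        (\<Sum>i<N. X i * (R i - M * \<alpha> * int i)) + M * (\<alpha> * (\<Sum>i<N. int i * X i))" .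
      have "int N * M dvd (\<Sum>i<N. X i * (R i - M * \<alpha> * int i))"
        using moment[folded R_def] by (intro dvd_sum dvd_mult) auto
      moreover have "int N * M dvd M * (\<alpha> * (\<Sum>i<N. int i * X i))"
        using mult_dvd_mono[OF dvd_refl[of M] dvd_mult[OF X1, of \<alpha>]] by (simp only: mult.commute[of M "int N"])
      ultimately have "int N * M dvd M * (\<Sum>j<N. int j * y (e j))"
        unfolding e1 by (rule dvd_add)
      then have "M * int N dvd M * (\<Sum>j<N. int j * y (e j))" by (simp only: mult.commute[of M "int N"])
      then have y1: "int N dvd (\<Sum>j<N. int j * y (e j))" using M by simp
      have "T (\<lambda>b. real_of_int (x b)) a = real_of_int (y a)" if a: "a \<in> carrier G" for a
      proof -
        have "T (\<lambda>b. real_of_int (x b)) a = real_of_int (Y (ix a)) / real_of_int M"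
          by (simp add: T_def Y_def X_def)
        also have "real_of_int (Y (ix a)) = real_of_int M * real_of_int (y a)"
          using y_e[of "ix a"] e_ix[OF a] by (metis of_int_mult)
        finally show ?thesis using Mpos by simp
      qed
      then show ?thesis using y0 y1 by (intro exI[of _ y]) (simp add: lattice_fun_e)
    qed
    show "lattice_fun x" unfolding x_def using eG by (intro lattice_fun_diff_single fin) auto
    show "\<bar>T (\<lambda>b. real_of_int (x b)) (e 1)\<bar> \<noteq> \<bar>real_of_int (x b)\<bar>" if "b \<in> carrier G" for b
    proof -
      have N1: "1 < N" "0 < N" using N3 by auto
      have e0: "\<one> = e 0" by (simp add: e_def)
      have xe: "x (e i) = int N * ((if i = 1 then 1 else 0) - (if i = 0 then 1 else 0))" if "i < N" for i
      proof -
        have "e i = e k \<longleftrightarrow> i = k" if "k < N" for k using ix_e[OF that] ix_e[OF \<open>i < N\<close>] by metis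
        then show ?thesis using N1 by (simp add: x_def single_def e0)
      qed
      have "(\<Sum>i<N. real_of_int (B i 1) * real_of_int (x (e i)))
          = (\<Sum>i<N. (if i = 1 then real N * real_of_int (B i 1) else 0) - (if i = 0 then real N * real_of_int (B i 1) else 0))"
        by (intro sum.cong) (auto simp: xe)
      also have "\<dots> = real N" using N1 B01 by (simp add: sum_subtractf)
      finally have "T (\<lambda>b. real_of_int (x b)) (e 1) = real N / real_of_int M"
        using N1 by (simp add: T_def ix_e)
      moreover have "0 < real N / real_of_int M" "real N / real_of_int M < real N"
        using M N1 by (auto simp: divide_less_eq)
      moreover have "x b \<in> {0, int N, - int N}" by (simp add: x_def single_def)
      ultimately show ?thesis by auto
    qed
  qed (use N3 eG in auto)
qed

end

text \<open>
  For prime \<open>p\<close>, the matrix with entries \<open>r (i * j mod p)\<close> for nonzero \<open>i\<close>, \<open>j\<close> is \<open>p\<close> times an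
  orthogonal matrix preserving the lattice for suitable representatives \<open>r k\<close> of the residues \<open>k\<close>.
  The lists for 5, 7, 10 and 11 were found by computer; the entries for \<open>n = 10\<close> depend in addition on
  whether \<open>i\<close> and \<open>j\<close> lie in the same coset of the subgroup of order 5.
\<close>

definition residue_matrix :: "int list \<Rightarrow> nat \<Rightarrow> nat \<Rightarrow> int" where
  "residue_matrix r i j = (if i = 0 \<or> j = 0 then (if i = j then int (length r) else 0) else r ! (i * j mod length r))"

definition residue_matrix_10 :: "nat \<Rightarrow> nat \<Rightarrow> int" where
  "residue_matrix_10 i j = (if i mod 5 = 0 \<or> j mod 5 = 0 then (if i = j then 5 else 0)
     else (if even (i + j) then [0, 1, 2, 3, -1] else [0, 1, 2, -2, -1]) ! (i * j mod 5))"

text \<open>The conditions of \<open>not_iso_cyclic\<close> on \<open>B\<close>, phrased with lists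
  and list sums so that \<open>code_simp\<close> can evaluate them.\<close>

definition cyclic_witness :: "nat \<Rightarrow> int \<Rightarrow> int \<Rightarrow> (nat \<Rightarrow> nat \<Rightarrow> int) \<Rightarrow> bool" where
  "cyclic_witness n M \<alpha> B \<longleftrightarrow>
    list_all (\<lambda>i. list_all (\<lambda>j. M dvd B i j - int (i * j)) [0..<n]
      \<and> (\<Sum>j\<leftarrow>[0..<n]. B i j) = M
      \<and> int n * M dvd (\<Sum>j\<leftarrow>[0..<n]. int j * B i j) - M * \<alpha> * int i
      \<and> list_all (\<lambda>k. (\<Sum>j\<leftarrow>[0..<n]. B i j * B k j) = (if i = k then M\<^sup>2 else 0)) [0..<n]) [0..<n]
    \<and> B 0 1 = 0 \<and> B 1 1 = 1"

text \<open>Row 0 aside, the rows of the matrices for 5, 7 and 11 are rearrangements of the list, so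
  its sum must be \<open>M\<close> and its sum of squares \<open>M^2\<close>; for 10 the two lists
  achieve this jointly. The multiplier \<open>\<alpha>\<close> is the sum of
  \<open>j * B 1 j\<close> divided by \<open>M\<close>.\<close>

lemma cyclic_witness_5: "cyclic_witness 5 5 3 (residue_matrix [0, 1, 2, -2, 4])"
  by code_simp

lemma cyclic_witness_7: "cyclic_witness 7 7 3 (residue_matrix [0, 1, 2, 3, -3, 5, -1])"
  by code_simp

lemma cyclic_witness_10: "cyclic_witness 10 5 1 residue_matrix_10"
  by code_simp

lemma cyclic_witness_11: "cyclic_witness 11 11 1 (residue_matrix [0, 1, 2, 3, 4, 5, 6, -4, -3, -2, -1])"
  by code_simp

context indexed_abelian_group
begin

lemma not_iso_cyclic_witness:
  assumes "N \<ge> 3" "c \<in> carrier G" "ord c = N" "M > 1" "M dvd int N" and B: "cyclic_witness N M \<alpha> B"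
  shows "\<not> LatticeAutoGroup L \<cong> C2Hol"
proof (rule not_iso_cyclic[where B = B and M = M and \<alpha> = \<alpha>])
qed (use assms in \<open>auto simp: cyclic_witness_def list_all_iff interv_sum_list_conv_sum_set_nat atLeast0LessThan\<close>)

lemma not_iso_small:
  assumes "N \<in> {5, 7, 8, 9, 10, 11}"
  shows "\<not> LatticeAutoGroup L \<cong> C2Hol"
proof -
  from assms consider "N = 5" | "N = 7" | "N = 8" | "N = 9" | "N = 10" | "N = 11" by blast
  then show ?thesis
  proof cases
    case 1
    then obtain c where "c \<in> carrier G" "ord c = N" using prime_order_generator[OF fin] by auto
    then show ?thesis
      by (rule not_iso_cyclic_witness[rotated]) (use 1 cyclic_witness_5 in auto)
  next
    case 2
    then obtain c where "c \<in> carrier G" "ord c = N" using prime_order_generator[OF fin] by auto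
    then show ?thesis
      by (rule not_iso_cyclic_witness[rotated]) (use 2 cyclic_witness_7 in auto)
  next
    case 5
    then obtain c where "c \<in> carrier G" "ord c = N" using order_10_generator[OF fin] by auto
    then show ?thesis
      by (rule not_iso_cyclic_witness[rotated]) (use 5 cyclic_witness_10 in auto)
  next
    case 6
    then obtain c where "c \<in> carrier G" "ord c = N" using prime_order_generator[OF fin] by auto
    then show ?thesis
      by (rule not_iso_cyclic_witness[rotated]) (use 6 cyclic_witness_11 in auto)
  qed (use not_iso_8 not_iso_9 in auto)
qed

end

theorem theorem1p3:
  fixes G :: "('a, 'b) monoid_scheme"
    and g :: "'n::finite \<Rightarrow> 'a"
    and i\<^sub>0 :: 'n
    and n :: nat
  assumes "comm_group G"
    and "finite (carrier G)"
    and "order G = n"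
    and "n \<ge> 3"
    and "bij_betw g UNIV (carrier G)"
    and "g i\<^sub>0 = \<one>\<^bsub>G\<^esub>"
  shows "LatticeAutoGroup (group_lattice G g i\<^sub>0) \<cong> integer_mod_group 2 \<times>\<times> holomorph G
         \<longleftrightarrow> n \<in> {3, 4, 6} \<or> n \<ge> 12"
proof -
  interpret indexed_abelian_group G g i\<^sub>0
    using assms by (simp add: indexed_abelian_group_def indexed_abelian_group_axioms_def)
  show ?thesis
  proof (cases "n \<in> {3, 4, 6} \<or> n \<ge> 12")
    case True
    then have "LatticeAutoGroup L \<cong> C2Hol"
      using iso_if_act_surj[OF _ act_surj] assms(3,4) by simp
    with True show ?thesis by blast
  next
    case False
    then have "N \<in> {5, 7, 8, 9, 10, 11}" using assms(3,4) by auto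
    with False show ?thesis using not_iso_small by blast
  qed
qed

end
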